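(* Thompson's group $F$ is in $TC_\rho$ with $\rho$ linear. More specifically, the Cayley complex $X$ of the presentation $$F=\langle x_0,x_1 \mid [x_0x_1^{-1},x_0^{-1}x_1x_0],\ [x_0x_1^{-1},x_0^{-2}x_1x_0^2] \rangle$$ has a 1-combing admitting the radial tameness function $\rho(q)=4q+45$.
   Context: Let $G=\langle A\mid R\rangle$ be a finitely presented group with $A$ inverse-closed and $R=\{r_1,\dots,r_k\}$, $r_i$ of length $n_i$; let $X$ be its Cayley 2-complex, with $X^0=G$, $X^1$ the Cayley graph, $\epsilon$ the identity vertex. Levels: for $g\in X^0$, $\mathrm{lev}(g)$ is the word length of $g$ over $A$; for $x$ in the interior of an edge with endpoints $g,h$, $\mathrm{lev}(x)=\frac{\mathrm{lev}(g)+\mathrm{lev}(h)}{2}+\frac14$; for $x$ in the interior of a 2-cell with boundary vertices $g_1,\dots,g_n$ (listed along the boundary), $\mathrm{lev}(x)=\frac{\mathrm{lev}(g_1)+\cdots+\mathrm{lev}(g_n)}{n}+\frac14+\frac1c$ where $c=4n_1n_2\cdots n_k+1$. A 1-combing is a continuous $\Psi:X^1\times[0,1]\to X$ with $\Psi(x,0)=\epsilon$, $\Psi(x,1)=x$ for all $x\in X^1$, and $\Psi(X^0\times[0,1])\subseteq X^1$. A function $\rho:\mathbb{Q}\to\mathbb{R}_+$ is a radial tameness function for $\Psi$ if for all $x\in X^1$, $0\le s<t\le1$ and $q\in\mathbb{Q}$, $\mathrm{lev}(\Psi(x,s))>\rho(q)$ implies $\mathrm{lev}(\Psi(x,t))>q$.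 The pair (group, presentation) is in $TC_\rho$ if its Cayley complex admits a 1-combing with radial tameness function $\rho$. *)

theory Defs
  imports "HOL-Analysis.Analysis"
begin

datatype gen = x0 | x1

text \<open>A letter is a generator with a sign (True = positive, False = inverse).
  The inverse-closed generating set A = {x0, x1, x0^-1, x1^-1} is thus the set of letters.\<close>
type_synonym letter = "gen \<times> bool"

definition linv :: "letter \<Rightarrow> letter" where
  "linv a = (fst a, \<not> snd a)"

definition winv :: "letter list \<Rightarrow> letter list" where
  "winv w = rev (map linv w)"

definition comm :: "letter list \<Rightarrow> letter list \<Rightarrow> letter list" where
  "comm a b = a @ b @ winv a @ winv b"

definition rel1 :: "letter list" where
  "rel1 = comm [(x0,True),(x1,False)] [(x0,False),(x1,True),(x0,True)]"

definition rel2 :: "letter list" where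
  "rel2 = comm [(x0,True),(x1,False)]
               [(x0,False),(x0,False),(x1,True),(x0,True),(x0,True)]"

definition rels :: "letter list list" where
  "rels = [rel1, rel2]"

inductive eqv :: "letter list \<Rightarrow> letter list \<Rightarrow> bool" where
  eqv_refl: "eqv w w"
| eqv_sym: "eqv u v \<Longrightarrow> eqv v u"
| eqv_trans: "eqv u v \<Longrightarrow> eqv v w \<Longrightarrow> eqv u w"
| eqv_cancel: "eqv (u @ [a, linv a] @ v) (u @ v)"
| eqv_rel: "r \<in> set rels \<Longrightarrow> eqv (u @ r @ v) (u @ v)"

lemma equivp_eqv: "equivp eqv"
  by (rule equivpI)
     (auto simp: reflp_def symp_def transp_def intro: eqv.intros)

quotient_type F_elt = "letter list" / eqv
  morphisms rep_F abs_F
  by (rule equivp_eqv)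

definition one_F :: F_elt where "one_F = abs_F []"

definition act :: "F_elt \<Rightarrow> letter \<Rightarrow> F_elt" where
  "act g a = abs_F (rep_F g @ [a])"

definition actw :: "F_elt \<Rightarrow> letter list \<Rightarrow> F_elt" where
  "actw g w = foldl act g w"

definition wl :: "F_elt \<Rightarrow> nat" where
  "wl g = (LEAST n. \<exists>w. length w = n \<and> abs_F w = g)"

text \<open>Points: vertices; interior points of edges (edge from g to g x_s, parameter t in (0,1));
  interior points of 2-cells (one 2-cell for every g and every relator i, with
  parameter p in the open unit disk of the complex plane).\<close>
datatype pt = V F_elt | E F_elt gen real | C F_elt nat complex

definition Xcar :: "pt set" where
  "Xcar = range V \<union> {E g s t | g s t. 0 < t \<and> t < 1}
          \<union> {C g i p | g i p. i < length rels \<and> norm p < 1}"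

definition X1 :: "pt set" where
  "X1 = range V \<union> {E g s t | g s t. 0 < t \<and> t < 1}"

definition X0 :: "pt set" where
  "X0 = range V"

definition emap :: "F_elt \<Rightarrow> gen \<Rightarrow> real \<Rightarrow> pt" where
  "emap g s t = (if t \<le> 0 then V g else if t \<ge> 1 then V (act g (s,True)) else E g s t)"

definition trav :: "F_elt \<Rightarrow> letter \<Rightarrow> real \<Rightarrow> pt" where
  "trav h a t = (if snd a then emap h (fst a) t else emap (act h a) (fst a) (1 - t))"

definition ang :: "complex \<Rightarrow> real" where
  "ang p = (if Arg p \<ge> 0 then Arg p else Arg p + 2 * pi)"

text \<open>Characteristic map of the 2-cell based at g for relator i: the open disk goes to
  the interior, the boundary circle is divided into n_i arcs which are mapped
  successively along the loop reading relator i from g.\<close>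
definition cmap :: "F_elt \<Rightarrow> nat \<Rightarrow> complex \<Rightarrow> pt" where
  "cmap g i p = (if norm p < 1 then C g i p else
     (let r = rels ! i; n = length r; u = real n * ang p / (2 * pi); k = nat \<lfloor>u\<rfloor>
      in trav (actw g (take k r)) (r ! k) (u - real k)))"

definition X_open :: "pt set \<Rightarrow> bool" where
  "X_open U \<longleftrightarrow> U \<subseteq> Xcar
     \<and> (\<forall>g s. openin (top_of_set {0..1::real}) {t \<in> {0..1}. emap g s t \<in> U})
     \<and> (\<forall>g i. i < length rels \<longrightarrow>
          openin (top_of_set (cball (0::complex) 1)) {p \<in> cball 0 1. cmap g i p \<in> U})"

lemma istopology_X_open: "istopology X_open"
  unfolding istopology_def
proof (intro conjI allI impI ballI)
  fix S T assume ST: "X_open S" "X_open T"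
  have e: "{t \<in> A. f t \<in> S \<inter> T} = {t \<in> A. f t \<in> S} \<inter> {t \<in> A. f t \<in> T}" for A and f :: "'b \<Rightarrow> pt" by auto
  show "X_open (S \<inter> T)"
    using ST unfolding X_open_def e by (auto intro!: openin_Int)
next
  fix K assume K: "\<forall>S\<in>K. X_open S"
  have e: "{t \<in> A. f t \<in> \<Union>K} = (\<Union>S\<in>K. {t \<in> A. f t \<in> S})" for A and f :: "'b \<Rightarrow> pt" by auto
  show "X_open (\<Union>K)" using K unfolding X_open_def e
    by (auto intro!: openin_Union)
qed

definition XT :: "pt topology" where
  "XT = topology X_open"

definition cconst :: real where
  "cconst = 4 * real (prod_list (map length rels)) + 1"

definition lev :: "pt \<Rightarrow> real" where
  "lev x = (case x of
      V g \<Rightarrow> real (wl g)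
    | E g s t \<Rightarrow> (real (wl g) + real (wl (act g (s,True)))) / 2 + 1/4
    | C g i p \<Rightarrow> (let r = rels ! i; n = length r in
         (\<Sum>k<n. real (wl (actw g (take k r)))) / real n + 1/4 + 1 / cconst))"

definition is_1combing :: "(pt \<times> real \<Rightarrow> pt) \<Rightarrow> bool" where
  "is_1combing \<Psi> \<longleftrightarrow>
     continuous_map (prod_topology (subtopology XT X1) (top_of_set {0..1})) XT \<Psi>
     \<and> (\<forall>x\<in>X1. \<Psi> (x, 0) = V one_F \<and> \<Psi> (x, 1) = x)
     \<and> (\<forall>x\<in>X0. \<forall>t\<in>{0..1}. \<Psi> (x, t) \<in> X1)"

definition radial_tameness :: "(rat \<Rightarrow> real) \<Rightarrow> (pt \<times> real \<Rightarrow> pt) \<Rightarrow> bool" where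
  "radial_tameness \<rho> \<Psi> \<longleftrightarrow>
     (\<forall>x\<in>X1. \<forall>s t q. 0 \<le> s \<and> s < t \<and> t \<le> 1 \<longrightarrow>
        lev (\<Psi> (x, s)) > \<rho> q \<longrightarrow> lev (\<Psi> (x, t)) > real_of_rat q)"

end

(*
  Elements of F act on Belk and Brown's forest diagrams: x0 moves a pointer along a
  bi-infinite sequence of binary trees with dyadic leaves, and x1 splits the tree at the pointer.
  Moving the pointer towards the rightmost non-trivial place and simplifying there gives every
  element a parent, hence a tree of paths to the identity. All x0-edges lie in this tree; every
  x1-edge outside it lies on a 2-cell whose other edges are in the tree or come earlier in a
  well-founded order. Combing an edge outside the tree means combing the rest of the boundary of
  this cell and then sweeping across the cell. The number N of leaves that matter in a forest never
  decreases along these paths, and N - 1 <= word length <= 4 N, which yields the linear tameness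
  function.
*)
theory Submission
  imports Defs
begin

section \<open>The group\<close>

text \<open>The group is given only by its presentation, and the relators show merely that forest
  states are well defined (\<open>foldl_ap_eqv\<close>). That the state determines the element is
  not presupposed: the cells that later carry the sweeps first prove it, because the end
  \<open>root\<close> of the chain of parents is constant along every edge
  (\<open>root_edge\<close>). The bound of word length by 4 N rests on this. Up to the position of
  the pointer, the relators say that a split at the pointer commutes with a split one or two trees
  to its right. So an \<open>x1\<close>-edge is filled directly when the target is at distance 1 or
  2. At distance 3 or more the trees 1 and 2 are joined instead, which leaves three sides that need
  not be in the tree; \<open>edge_less\<close> is designed for them. In each filling cell N is
  largest at the split end of the edge, so N does not fall when the sweep arrives there. A boundary
  has at most 14 vertices, whose word lengths differ by at most 7; this gives N <= level + 8 and
  level <= 4 N + 1, a total loss of 4 * 8 + 1 = 33, within the 45.\<close>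

lemma abs_F_eq_iff: "abs_F u = abs_F v \<longleftrightarrow> eqv u v"
  by (rule F_elt.abs_eq_iff)

lemma abs_F_rep_F [simp]: "abs_F (rep_F g) = g"
  by (meson Quotient3_F_elt Quotient3_abs_rep)

lemma eqv_rep_F_abs_F: "eqv (rep_F (abs_F w)) w"
  by (simp flip: abs_F_eq_iff)

lemma eqv_append: "eqv u v \<Longrightarrow> eqv (a @ u @ b) (a @ v @ b)"
proof (induction rule: eqv.induct)
  case (eqv_cancel u c v)
  then show ?case using eqv.eqv_cancel[of "a @ u" c "v @ b"] by simp
next
  case (eqv_rel r u v)
  then show ?case using eqv.eqv_rel[of r "a @ u" "v @ b"] by simp
qed (auto intro: eqv.intros)

lemma act_abs_F [simp]: "act (abs_F w) a = abs_F (w @ [a])"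
  unfolding act_def abs_F_eq_iff using eqv_append[OF eqv_rep_F_abs_F, of "[]" w "[a]"] by simp

lemma actw_abs_F [simp]: "actw (abs_F u) w = abs_F (u @ w)"
  by (induction w rule: rev_induct) (simp_all add: actw_def flip: append_assoc)

lemma actw_Nil [simp]: "actw g [] = g"
  and actw_Cons [simp]: "actw g (a # w) = actw (act g a) w"
  by (simp_all add: actw_def)

lemma actw_append: "actw g (u @ v) = actw (actw g u) v"
  by (simp add: actw_def)

lemma linv_linv [simp]: "linv (linv a) = a"
  by (simp add: linv_def)

lemma act_linv [simp]: "act (act g a) (linv a) = g"
proof -
  obtain w where "g = abs_F w" by (metis abs_F_rep_F)
  then show ?thesis using eqv_cancel[of w a "[]"] by (simp add: abs_F_eq_iff)
qed

lemma act_linv' [simp]: "act (act g (linv a)) a = g"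
  using act_linv[of g "linv a"] by simp

lemma act_inverse [simp]:
  "act (act g (s, True)) (s, False) = g" "act (act g (s, False)) (s, True) = g"
  using act_linv[of g "(s, True)"] act_linv[of g "(s, False)"] by (simp_all add: linv_def)

lemma actw_rel:
  assumes "r \<in> set rels"
  shows "actw g r = g"
proof -
  obtain w where "g = abs_F w" by (metis abs_F_rep_F)
  then show ?thesis using eqv_rel[OF assms, of w "[]"] by (simp add: abs_F_eq_iff)
qed

lemma wl_attained: "\<exists>w. length w = wl g \<and> abs_F w = g"
  unfolding wl_def by (rule LeastI_ex) (metis abs_F_rep_F)

lemma wl_le: "wl (abs_F w) \<le> length w"
  unfolding wl_def by (rule Least_le) blast

lemma wl_act_le: "wl (act g a) \<le> wl g + 1"
  using wl_attained[of g] wl_le act_abs_F by (metis length_append_singleton Suc_eq_plus1)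

lemma wl_act_ge: "wl g \<le> wl (act g a) + 1"
  using wl_act_le[of "act g a" "linv a"] by simp

lemma wl_actw_ge: "wl g \<le> wl (actw g w) + length w"
proof (induction w arbitrary: g)
  case (Cons a w)
  have "wl (act g a) \<le> wl (actw (act g a) w) + length w" by (rule Cons)
  then show ?case using wl_act_ge[of g a] by simp
qed simp

section \<open>Forest states\<close>

text \<open>The leaf \<open>Lf a k\<close> stands for the dyadic interval from \<open>a / 2 ^ k\<close> to \<open>(a + 1) / 2 ^ k\<close>. A state
  lists the trees of a forest from left to right, with the pointer at the tree of index 0.\<close>
datatype tree = Lf int nat | Nd tree tree

type_synonym state = "int \<Rightarrow> tree"

fun sib :: "tree \<Rightarrow> tree \<Rightarrow> bool" where
  "sib (Lf a k) (Lf b j) \<longleftrightarrow> k = j \<and> 0 < k \<and> even a \<and> b = a + 1"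
| "sib _ _ \<longleftrightarrow> False"

fun lch :: "tree \<Rightarrow> tree" where
  "lch (Lf a k) = Lf (2 * a) (Suc k)"
| "lch (Nd l r) = l"

fun rch :: "tree \<Rightarrow> tree" where
  "rch (Lf a k) = Lf (2 * a + 1) (Suc k)"
| "rch (Nd l r) = r"

text \<open>A caret over two sibling leaves is replaced by their common parent interval, so forests
  stay reduced and splitting undoes joining.\<close>

definition join :: "tree \<Rightarrow> tree \<Rightarrow> tree" where
  "join t u = (if sib t u then (case t of Lf a k \<Rightarrow> Lf (a div 2) (k - 1) | _ \<Rightarrow> t) else Nd t u)"

fun lo :: "tree \<Rightarrow> real" where
  "lo (Lf a k) = of_int a / 2 ^ k"
| "lo (Nd l r) = lo l"

fun hi :: "tree \<Rightarrow> real" where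
  "hi (Lf a k) = of_int (a + 1) / 2 ^ k"
| "hi (Nd l r) = hi r"

text \<open>Reduced trees over adjacent intervals. Excluding a caret over siblings makes the
  representation unique, as \<open>join_lch_rch\<close> requires.\<close>

fun ok :: "tree \<Rightarrow> bool" where
  "ok (Lf a k) \<longleftrightarrow> True"
| "ok (Nd l r) \<longleftrightarrow> ok l \<and> ok r \<and> hi l = lo r \<and> \<not> sib l r"

text \<open>The number of leaves plus \<open>w\<close> times the number of carets.\<close>
fun wt :: "nat \<Rightarrow> tree \<Rightarrow> nat" where
  "wt w (Lf a k) = 1"
| "wt w (Nd l r) = wt w l + wt w r + w"

lemma wt_pos: "0 < wt w t"
  by (induction t) auto

lemma sibE:
  assumes "sib t u"
  obtains a k where "t = Lf (2 * a) (Suc k)" "u = Lf (2 * a + 1) (Suc k)"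
proof (cases "(t, u)" rule: sib.cases)
  case (1 a k b j)
  then obtain c where "a = 2 * c" using assms by (auto elim: evenE)
  then show thesis using 1 assms that[of c "k - 1"] by auto
qed (use assms in auto)

lemma lch_join [simp]: "lch (join t u) = t"
  and rch_join [simp]: "rch (join t u) = u"
  by (cases "sib t u"; auto simp: join_def elim!: sibE)+

lemma join_lch_rch [simp]: "ok t \<Longrightarrow> join (lch t) (rch t) = t"
  by (cases t) (auto simp: join_def)

lemma ok_lch [simp]: "ok t \<Longrightarrow> ok (lch t)"
  and ok_rch [simp]: "ok t \<Longrightarrow> ok (rch t)"
  by (cases t; simp)+

lemma ok_join [simp]: "ok t \<Longrightarrow> ok u \<Longrightarrow> hi t = lo u \<Longrightarrow> ok (join t u)"
  by (auto simp: join_def elim!: sibE)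

lemma lo_lch [simp]: "lo (lch t) = lo t"
  by (cases t) auto

lemma hi_rch [simp]: "hi (rch t) = hi t"
  by (cases t) (auto simp: field_simps)

lemma hi_lch [simp]: "ok t \<Longrightarrow> hi (lch t) = lo (rch t)"
  by (cases t) auto

lemma lo_join [simp]: "lo (join t u) = lo t"
  using lo_lch[of "join t u"] by simp

lemma hi_join [simp]: "hi (join t u) = hi u"
  using hi_rch[of "join t u"] by simp

lemma wt_join: "wt w (join t u) = (if sib t u then 1 else wt w t + wt w u + w)"
  by (auto simp: join_def elim!: sibE)

lemma wt_sib: "sib t u \<Longrightarrow> wt w t = 1 \<and> wt w u = 1"
  by (auto elim!: sibE)

section \<open>Moving the pointer, splitting and joining trees\<close>

definition shift :: "int \<Rightarrow> state \<Rightarrow> state" where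
  "shift d s = (\<lambda>i. s (i + d))"

definition split_at :: "int \<Rightarrow> state \<Rightarrow> state" where
  "split_at j s = (\<lambda>i. if i < j then s i else if i = j then lch (s j)
     else if i = j + 1 then rch (s j) else s (i - 1))"

definition join_at :: "int \<Rightarrow> state \<Rightarrow> state" where
  "join_at j s = (\<lambda>i. if i < j then s i else if i = j then join (s j) (s (j + 1)) else s (i + 1))"

lemma shift_shift [simp]: "shift d (shift e s) = shift (d + e) s"
  by (simp add: shift_def fun_eq_iff algebra_simps)

lemma shift_0 [simp]: "shift 0 s = s"
  by (simp add: shift_def)

lemma shift_split_at [simp]: "shift d (split_at j s) = split_at (j - d) (shift d s)"
  by (auto simp: shift_def split_at_def fun_eq_iff algebra_simps)

lemma shift_join_at [simp]: "shift d (join_at j s) = join_at (j - d) (shift d s)"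
  by (auto simp: shift_def join_at_def fun_eq_iff algebra_simps)

lemma split_at_join_at [simp]: "split_at j (join_at j s) = s"
  by (auto simp: split_at_def join_at_def fun_eq_iff)

text \<open>Both relators express this commutation; the left split pushes the right one by one
  index.\<close>

lemma split_at_split_at: "i < j \<Longrightarrow> split_at i (split_at j s) = split_at (j + 1) (split_at i s)"
  by (rule ext) (auto simp: split_at_def)

text \<open>The leaves outside a window are unit intervals; those on the left lie left of the origin
  and those on the right lie to the right of the unit interval at the origin.\<close>
definition window :: "state \<Rightarrow> int \<Rightarrow> int \<Rightarrow> bool" where
  "window s jl jr \<longleftrightarrow> jl \<le> 0 \<and> 0 \<le> jr \<and> (\<forall>i<jl. \<exists>a<0. s i = Lf a 0) \<and> (\<forall>i>jr. \<exists>a>0. s i = Lf a 0)"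

definition cnt :: "nat \<Rightarrow> state \<Rightarrow> int \<Rightarrow> int \<Rightarrow> nat" where
  "cnt w s jl jr = (\<Sum>i\<in>{jl..jr}. wt w (s i))"

text \<open>For \<open>w = 0\<close> this is N, which is compared with word length; for
  \<open>w = 1\<close> carets count too. A window contains the pointer and, if it occurs, the leaf
  \<open>Lf 0 0\<close>, so N also records how far apart these are.\<close>

definition hm :: "nat \<Rightarrow> state \<Rightarrow> nat" where
  "hm w s = (LEAST n. \<exists>jl jr. window s jl jr \<and> cnt w s jl jr = n)"

definition valid :: "state \<Rightarrow> bool" where
  "valid s \<longleftrightarrow> (\<forall>i. ok (s i)) \<and> (\<forall>i. hi (s i) = lo (s (i + 1))) \<and> (\<exists>jl jr. window s jl jr)"

lemma join_at_split_at [simp]: "valid s \<Longrightarrow> join_at j (split_at j s) = s"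
  by (rule ext) (auto simp: valid_def split_at_def join_at_def)

lemma hm_le: "window s jl jr \<Longrightarrow> hm w s \<le> cnt w s jl jr"
  unfolding hm_def by (rule Least_le) blast

lemma hm_attained:
  assumes "valid s"
  obtains jl jr where "window s jl jr" "cnt w s jl jr = hm w s"
proof -
  have "\<exists>n. \<exists>jl jr. window s jl jr \<and> cnt w s jl jr = n" using assms by (auto simp: valid_def)
  from LeastI_ex[OF this] show ?thesis using that unfolding hm_def by blast
qed

lemma window_shift: "window s jl jr \<Longrightarrow> jl \<le> d \<Longrightarrow> d \<le> jr \<Longrightarrow> window (shift d s) (jl - d) (jr - d)"
  by (auto simp: window_def shift_def)

lemma window_grow: "window s jl jr \<Longrightarrow> jl' \<le> jl \<Longrightarrow> jr \<le> jr' \<Longrightarrow> window s jl' jr'"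
  by (auto simp: window_def)

lemma cnt_shift: "cnt w (shift d s) (jl - d) (jr - d) = cnt w s jl jr"
  unfolding cnt_def shift_def
  by (rule sum.reindex_bij_witness[of _ "\<lambda>i. i - d" "\<lambda>i. i + d"]) auto

lemma window_split_at: "window s jl jr \<Longrightarrow> jl \<le> j \<Longrightarrow> j \<le> jr \<Longrightarrow> window (split_at j s) jl (jr + 1)"
  by (auto simp: window_def split_at_def)

lemma window_join_at: "window s jl jr \<Longrightarrow> jl \<le> j \<Longrightarrow> j < jr \<Longrightarrow> 0 < jr \<Longrightarrow> window (join_at j s) jl (jr - 1)"
  by (auto simp: window_def join_at_def)

lemma cnt_split_at:
  assumes "jl \<le> j" "j \<le> jr"
  shows "cnt w (split_at j s) jl (jr + 1) + wt w (s j)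
    = cnt w s jl jr + wt w (lch (s j)) + wt w (rch (s j))"
proof -
  let ?f = "\<lambda>i. wt w (s i)" and ?g = "\<lambda>i. wt w (split_at j s i)"
  have e: "{jl..jr + 1} = {jl..<j} \<union> ({j, j + 1} \<union> {j + 2..jr + 1})" "{jl..jr} = {jl..<j} \<union> ({j} \<union> {j + 1..jr})"
    using assms by auto
  have "sum ?g {j + 2..jr + 1} = sum ?f {j + 1..jr}"
    by (rule sum.reindex_bij_witness[of _ "\<lambda>i. i + 1" "\<lambda>i. i - 1"]) (auto simp: split_at_def)
  moreover have "sum ?g {jl..<j} = sum ?f {jl..<j}"
    by (rule sum.cong) (auto simp: split_at_def)
  moreover have "sum ?g {j, j + 1} = wt w (lch (s j)) + wt w (rch (s j))"
    by (simp add: split_at_def)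
  moreover have "sum ?g {jl..jr + 1} = sum ?g {jl..<j} + (sum ?g {j, j + 1} + sum ?g {j + 2..jr + 1})"
    unfolding e(1) by (subst sum.union_disjoint; (subst sum.union_disjoint)?; auto)
  moreover have "sum ?f {jl..jr} = sum ?f {jl..<j} + (?f j + sum ?f {j + 1..jr})"
    unfolding e(2) by (subst sum.union_disjoint; (subst sum.union_disjoint)?; auto)
  ultimately show ?thesis by (simp add: cnt_def)
qed

lemma cnt_join_at:
  assumes "jl \<le> j" "j < jr"
  shows "cnt w s jl jr + wt w (join (s j) (s (j + 1)))
    = cnt w (join_at j s) jl (jr - 1) + wt w (s j) + wt w (s (j + 1))"
proof -
  have "join_at j s j = join (s j) (s (j + 1))" by (simp add: join_at_def)
  then show ?thesis
    using cnt_split_at[of jl j "jr - 1" w "join_at j s"] assms by simp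
qed

lemma valid_shift: 
  assumes "valid s" shows "valid (shift d s)"
proof -
  from assms obtain jl jr where h: "window s jl jr" by (auto simp: valid_def)
  have "window (shift d s) (min jl d - d) (max jr d - d)"
    by (rule window_shift[OF window_grow[OF h]]) auto
  then show ?thesis using assms unfolding valid_def by (auto simp: shift_def algebra_simps)
qed

lemma valid_split_at_0: 
  assumes "valid s" shows "valid (split_at 0 s)"
proof -
  from assms obtain jl jr where h: "window s jl jr" by (auto simp: valid_def)
  have "window (split_at 0 s) jl (jr + 1)"
    by (rule window_split_at[OF h]) (use h in \<open>auto simp: window_def\<close>)
  moreover have "hi (s (- 1)) = lo (s 0)" "hi (s (i - 1)) = lo (s i)" for i
    using assms by (auto simp: valid_def)
  ultimately show ?thesis using assms unfolding valid_def
    by (auto simp: split_at_def add_eq_0_iff)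
qed

text \<open>A shift conjugates the split to one at the pointer, an index that every window
  contains.\<close>

lemma valid_split_at: "valid s \<Longrightarrow> valid (split_at j s)"
  using valid_shift[OF valid_split_at_0[OF valid_shift[of s j]], of "-j"] by simp

lemma valid_join_at_0: 
  assumes "valid s" shows "valid (join_at 0 s)"
proof -
  from assms obtain jl jr where h: "window s jl jr" by (auto simp: valid_def)
  \<comment> \<open>The window is first enlarged by one, so that the right partner of the join lies
    in it.\<close>
  have "window (join_at 0 s) jl (jr + 1 - 1)"
    by (rule window_join_at[OF window_grow[OF h]]) (use h in \<open>auto simp: window_def\<close>)
  moreover have "hi (s (- 1)) = lo (s 0)" "hi (s 0) = lo (s 1)" "hi (s 1) = lo (s 2)"
    using assms[unfolded valid_def, THEN conjunct2, THEN conjunct1, THEN spec, of "-1"]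
     assms[unfolded valid_def, THEN conjunct2, THEN conjunct1, THEN spec, of "0"]
     assms[unfolded valid_def, THEN conjunct2, THEN conjunct1, THEN spec, of "1"]
    by (auto simp: valid_def)
  ultimately show ?thesis using assms unfolding valid_def
    by (auto simp: join_at_def add_eq_0_iff)
qed

lemma valid_join_at: "valid s \<Longrightarrow> valid (join_at j s)"
  using valid_shift[OF valid_join_at_0[OF valid_shift[of s j]], of "-j"] by simp

section \<open>The action of the letters on states\<close>

definition init :: state where
  "init = (\<lambda>i. Lf i 0)"

lemma window_init: "window init 0 0"
  by (simp add: window_def init_def)

lemma valid_init: "valid init"
  unfolding valid_def using window_init by (auto simp: init_def)

text \<open>Right multiplication by \<open>x0\<close> moves the pointer to the left.\<close>
fun ap :: "state \<Rightarrow> letter \<Rightarrow> state" where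
  "ap s (x0, True) = shift (- 1) s"
| "ap s (x0, False) = shift 1 s"
| "ap s (x1, True) = split_at 0 s"
| "ap s (x1, False) = join_at 0 s"

lemma valid_ap: "valid s \<Longrightarrow> valid (ap s a)"
  by (cases "(s, a)" rule: ap.cases) (auto simp: valid_shift valid_split_at valid_join_at)

lemma valid_foldl_ap: "valid s \<Longrightarrow> valid (foldl ap s w)"
  by (induction w arbitrary: s) (auto simp: valid_ap)

lemma ap_linv: "valid s \<Longrightarrow> ap (ap s a) (linv a) = s"
  by (cases "(s, a)" rule: ap.cases) (auto simp: linv_def)

text \<open>Conjugation by \<open>x0\<close> turns a split at the pointer into a split elsewhere, so
  each relator reduces to two splits that commute up to a change of index.\<close>

lemma foldl_ap_rel:
  assumes "valid s" "r \<in> set rels"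
  shows "foldl ap s r = s"
  using assms
  by (auto simp: rels_def rel1_def rel2_def comm_def winv_def linv_def split_at_split_at valid_shift)

lemma foldl_ap_eqv: "eqv u v \<Longrightarrow> valid s \<Longrightarrow> foldl ap s u = foldl ap s v"
proof (induction rule: eqv.induct)
  case (eqv_cancel u a v)
  then show ?case using ap_linv[OF valid_foldl_ap] by simp
next
  case (eqv_rel r u v)
  then show ?case using foldl_ap_rel[OF valid_foldl_ap] by simp
qed auto

text \<open>A smallest window of \<open>s\<close> is reused, enlarged by one unit leaf if the
  pointer leaves it or the join lacks a right partner. A split adds a leaf only when it halves a
  leaf.\<close>

lemma hm_0_ap_le:
  assumes "valid s"
  shows "hm 0 (ap s a) \<le> hm 0 s + 1"
proof -
  obtain jl jr where h: "window s jl jr" "cnt 0 s jl jr = hm 0 s" using hm_attained[OF assms] .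
  have b: "jl \<le> 0" "0 \<le> jr" using h by (auto simp: window_def)
  show ?thesis
  proof (cases "(s, a)" rule: ap.cases)
    case (1 s')
    show ?thesis
    proof (cases "jl < 0")
      case True
      then have "hm 0 (shift (-1) s) \<le> cnt 0 (shift (-1) s) (jl - (-1)) (jr - (-1))"
        using b by (intro hm_le window_shift[OF h(1)]) auto
      then show ?thesis using 1 h unfolding cnt_shift by simp
    next
      case False
      then have [simp]: "jl = 0" using b by auto
      have "hm 0 (shift (-1) s) \<le> cnt 0 (shift (-1) s) (-1 - (-1)) (jr - (-1))"
        using b by (intro hm_le window_shift[OF window_grow[OF h(1)]]) auto
      moreover have "{-1..jr} = insert (-1) {0..jr}" using b by auto
      moreover have "\<forall>i<0. \<exists>a. s i = Lf a 0" using h(1) unfolding window_def by force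
      from this[rule_format, of "-1"] have "\<exists>a. s (-1) = Lf a 0" by simp
      ultimately show ?thesis using 1 h unfolding cnt_shift by (auto simp: cnt_def)
    qed
  next
    case (2 s')
    show ?thesis
    proof (cases "jr > 0")
      case True
      then have "hm 0 (shift 1 s) \<le> cnt 0 (shift 1 s) (jl - 1) (jr - 1)"
        using b by (intro hm_le window_shift[OF h(1)]) auto
      then show ?thesis using 2 h unfolding cnt_shift by simp
    next
      case False
      then have [simp]: "jr = 0" using b by auto
      have "hm 0 (shift 1 s) \<le> cnt 0 (shift 1 s) (jl - 1) (1 - 1)"
        using b by (intro hm_le window_shift[OF window_grow[OF h(1)]]) auto
      moreover have "{jl..1} = insert 1 {jl..0}" using b by auto
      moreover have "\<forall>i>0. \<exists>a. s i = Lf a 0" using h(1) unfolding window_def by force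
      from this[rule_format, of 1] have "\<exists>a. s 1 = Lf a 0" by simp
      ultimately show ?thesis using 2 h unfolding cnt_shift by (auto simp: cnt_def)
    qed
  next
    case (3 s')
    have "hm 0 (split_at 0 s) \<le> cnt 0 (split_at 0 s) jl (jr + 1)"
      using b by (intro hm_le window_split_at[OF h(1)]) auto
    then show ?thesis using 3 h cnt_split_at[OF b, of 0 s] by (cases "s 0") auto
  next
    case (4 s')
    have "hm 0 (join_at 0 s) \<le> cnt 0 (join_at 0 s) jl (max jr 1 - 1)"
      using b by (intro hm_le window_join_at[OF window_grow[OF h(1)]]) auto
    moreover have "cnt 0 s jl (max jr 1) \<le> cnt 0 s jl jr + 1"
    proof (cases "jr = 0")
      case True
      have "{jl..1} = insert 1 {jl..0}" using b by auto
      moreover have "\<forall>i>0. \<exists>a. s i = Lf a 0" using h(1) True unfolding window_def by force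
      from this[rule_format, of 1] have "\<exists>a. s 1 = Lf a 0" by simp
      ultimately show ?thesis using True by (auto simp: cnt_def)
    qed (use b in auto)
    moreover have "cnt 0 s jl (max jr 1) + wt 0 (join (s 0) (s 1))
        = cnt 0 (join_at 0 s) jl (max jr 1 - 1) + wt 0 (s 0) + wt 0 (s 1)"
      using cnt_join_at[of jl 0 "max jr 1" 0 s] b by simp
    ultimately show ?thesis using 4 h wt_join[of 0 "s 0" "s 1"] wt_pos[of 0 "s 0"] wt_pos[of 0 "s 1"] by (auto split: if_splits)
  qed
qed

lemma hm_0_init: "hm 0 init \<le> 1"
  using hm_le[OF window_init, of 0] by (simp add: cnt_def init_def)

text \<open>A place where the forest can be simplified, by removing a caret or by merging two
  sibling leaves.\<close>

definition obj :: "state \<Rightarrow> int \<Rightarrow> bool" where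
  "obj s i \<longleftrightarrow> (\<exists>l r. s i = Nd l r) \<or> sib (s i) (s (i + 1))"

lemma obj_shift [simp]: "obj (shift d s) i \<longleftrightarrow> obj s (i + d)"
  by (simp add: obj_def shift_def algebra_simps)

text \<open>Outside a window there are only leaves of level 0, which carry no caret and have no
  sibling.\<close>

lemma obj_window:
  assumes "window s jl jr" "obj s p"
  shows "jl \<le> p" "p \<le> jr" "sib (s p) (s (p + 1)) \<Longrightarrow> p < jr"
proof -
  have *: "\<exists>a. s i = Lf a 0" if "i < jl \<or> jr < i" for i
    using assms(1) that by (auto simp: window_def)
  have n: "\<not> obj s i" if "i < jl \<or> jr < i" for i
    using *[OF that] by (auto simp: obj_def elim: sibE)
  show "jl \<le> p" "p \<le> jr" using n[of p] assms(2) by linarith+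
  show "p < jr" if "sib (s p) (s (p + 1))"
  proof (rule ccontr)
    assume "\<not> p < jr"
    then have "\<exists>a. s (p + 1) = Lf a 0" by (intro *) auto
    then show False using that by (auto elim: sibE)
  qed
qed

text \<open>A leaf of maximal level has its sibling next to it.\<close>
lemma no_obj_imp_integers:
  assumes "valid s" and no: "\<And>i. \<not> obj s i"
  obtains c where "\<And>i. s i = Lf (i + c) 0"
proof -
  have "\<exists>a k. s i = Lf a k" for i using no[of i] by (cases "s i") (auto simp: obj_def)
  then obtain f k where s: "\<And>i. s i = Lf (f i) (k i)" by metis
  have adj: "of_int (f i + 1) / 2 ^ k i = (of_int (f (i + 1)) / 2 ^ k (i + 1) :: real)" for i
    using assms(1) unfolding valid_def s by (auto simp: algebra_simps)
  obtain jl jr where w: "window s jl jr" using assms(1) by (auto simp: valid_def)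
  have out: "k i = 0" if "i < jl \<or> jr < i" for i
    using w that unfolding window_def s by auto
  have "finite (k ` {jl..jr} \<union> {0})" by simp
  define K where "K = Max (k ` {jl..jr} \<union> {0})"
  have le: "k i \<le> K" for i
    using out[of i] unfolding K_def by (cases "i < jl \<or> jr < i") (auto intro!: Max_ge)
  have "K \<in> k ` {jl..jr} \<union> {0}" unfolding K_def by (rule Max_in) auto
  \<comment> \<open>A dyadic fraction with odd numerator is in lowest terms, so an equal one with
    exponent at most \<open>K\<close> has the same numerator and exponent.\<close>
  have lev: "b = a \<and> j = K" if "odd a" "j \<le> K" "of_int a / 2 ^ K = (of_int b / 2 ^ j :: real)"
    for a b :: int and j
  proof -
    have "(2::real) ^ K = 2 ^ j * 2 ^ (K - j)" using that(2) by (simp flip: power_add)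
    then have "(of_int a :: real) = of_int (b * 2 ^ (K - j))" using that(3) by (simp add: field_simps)
    then have "a = b * 2 ^ (K - j)" by (simp only: of_int_eq_iff)
    then have "K - j = 0" using that(1) by (cases "K - j") auto
    then show ?thesis using \<open>a = _\<close> that(2) by auto
  qed
  have "K = 0"
  proof (rule ccontr)
    assume "K \<noteq> 0"
    then obtain i where i: "k i = K" using \<open>K \<in> _\<close> by auto
    show False
    \<comment> \<open>For an even numerator the right end point has odd numerator
      \<open>f i + 1\<close>, and the sibling follows; for an odd one the left end point is in
      lowest terms, and the sibling precedes.\<close>
    proof (cases "even (f i)")
      case True
      then have "f (i + 1) = f i + 1 \<and> k (i + 1) = K"
        using adj[of i] le[of "i + 1"] by (intro lev) (auto simp: i)
      then have "obj s i" using True i \<open>K \<noteq> 0\<close> by (auto simp: obj_def s)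
      then show False using no by blast
    next
      case False
      then have "f (i - 1) + 1 = f i \<and> k (i - 1) = K"
        using adj[of "i - 1"] le[of "i - 1"] by (intro lev) (auto simp: i)
      moreover from this have "even (f (i - 1))" using False by (metis odd_add odd_one)
      ultimately have "obj s (i - 1)" using False i \<open>K \<noteq> 0\<close> by (auto simp: obj_def s)
      then show False using no by blast
    qed
  qed
  then have k0: "k i = 0" for i using le[of i] by simp
  have step: "f (i + 1) = f i + 1" for i
  proof -
    have "(of_int (f (i + 1)) :: real) = of_int (f i + 1)" using adj[of i] by (simp add: k0)
    then show ?thesis by (simp only: of_int_eq_iff)
  qed
  have "f i = i + f 0" for i
  proof (induction i rule: int_induct[where k = 0])
    case (step2 i)
    then show ?case using step[of "i - 1"] by simp
  qed (auto simp: step)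
  then show thesis using that[of "f 0"] s k0 by metis
qed

text \<open>The second alternative concerns shifts of \<open>init\<close>, where nothing is left to
  simplify and the pointer only has to return to the origin.\<close>

definition target :: "state \<Rightarrow> int \<Rightarrow> bool" where
  "target s p \<longleftrightarrow> obj s p \<and> (\<forall>i>p. \<not> obj s i) \<or> (\<forall>i. \<not> obj s i) \<and> s p = Lf 0 0"

definition pm :: "state \<Rightarrow> int" where
  "pm s = (THE p. target s p)"

lemma target_unique:
  assumes "valid s" "target s p" "target s q"
  shows "p = q"
proof (cases "\<exists>i. obj s i")
  case True
  then show ?thesis using assms(2,3) unfolding target_def by (meson not_less_iff_gr_or_eq)
next
  case False
  then obtain c where "\<And>i. s i = Lf (i + c) 0" using no_obj_imp_integers[OF assms(1)] by metis
  then show ?thesis using assms(2,3) False by (auto simp: target_def)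
qed

lemma target_ex:
  assumes "valid s"
  shows "\<exists>p. target s p"
proof (cases "\<exists>i. obj s i")
  case True
  obtain jl jr where w: "window s jl jr" using assms(1) by (auto simp: valid_def)
  have fin: "finite {i. obj s i}"
    by (rule finite_subset[of _ "{jl..jr}"]) (use obj_window[OF w] in auto)
  have "target s (Max {i. obj s i})"
    using Max_in[OF fin] Max_ge[OF fin] True unfolding target_def by fastforce
  then show ?thesis ..
next
  case False
  then obtain c where "\<And>i. s i = Lf (i + c) 0" using no_obj_imp_integers[OF assms(1)] by metis
  then show ?thesis using False by (auto simp: target_def intro!: exI[of _ "- c"])
qed

lemma pm_eqI: "valid s \<Longrightarrow> target s p \<Longrightarrow> pm s = p"
  unfolding pm_def by (rule the_equality) (auto dest: target_unique)

lemma target_pm: "valid s \<Longrightarrow> target s (pm s)"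
  using target_ex pm_eqI by metis

lemma pm_shift: "valid s \<Longrightarrow> pm (shift d s) = pm s - d"
proof (rule pm_eqI)
  assume v: "valid s"
  then have t: "target s (pm s)" by (rule target_pm)
  have "\<not> obj s (i + d)" if "pm s - d < i" "obj s (pm s)" for i
    using t that unfolding target_def by (metis diff_less_eq)
  then show "target (shift d s) (pm s - d)"
    using t unfolding target_def by (auto simp: shift_def[of d s, THEN fun_cong])
qed (rule valid_shift)

text \<open>Every simplifiable place lies in every window, and so does \<open>Lf 0 0\<close>, which
  is neither left nor right of the origin. Hence a pointer moving towards the target stays inside
  each window.\<close>

lemma window_pm:
  assumes "valid s" "window s jl jr"
  shows "jl \<le> pm s" "pm s \<le> jr"
proof -
  have "jl \<le> pm s \<and> pm s \<le> jr"
  proof (cases "obj s (pm s)")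
    case False
    then have 1: "s (pm s) = Lf 0 0" using target_pm[OF assms(1)] by (auto simp: target_def)
    show ?thesis using assms(2) 1 unfolding window_def
      by (metis linorder_not_le order_less_irrefl tree.inject(1))
  qed (use obj_window[OF assms(2)] in auto)
  then show "jl \<le> pm s" "pm s \<le> jr" by auto
qed

text \<open>The pointer moves to the target, where a caret is removed or two sibling leaves are merged.\<close>
definition dirn :: "state \<Rightarrow> letter" where
  "dirn s = (if pm s < 0 then (x0, True) else if 0 < pm s then (x0, False)
     else if \<exists>l r. s 0 = Nd l r then (x1, True) else (x1, False))"

lemma not_init_pm_0:
  assumes "valid s" "s \<noteq> init" "pm s = 0"
  shows "obj s 0" "\<And>i. 0 < i \<Longrightarrow> \<not> obj s i"
proof -
  have "obj s 0 \<and> (\<forall>i>0. \<not> obj s i)"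
  proof (rule ccontr)
    assume *: "\<not> ?thesis"
    then have 0: "\<And>i. \<not> obj s i" "s 0 = Lf 0 0"
      using target_pm[OF assms(1)] assms(3) unfolding target_def by auto
    obtain c where "\<And>i. s i = Lf (i + c) 0" using no_obj_imp_integers[OF assms(1) 0(1)] by metis
    then show False using 0(2) assms(2) by (auto simp: init_def fun_eq_iff)
  qed
  then show "obj s 0" "\<And>i. 0 < i \<Longrightarrow> \<not> obj s i" by auto
qed

lemma hm_shift_towards_pm:
  assumes "valid s" "min 0 (pm s) \<le> d" "d \<le> max 0 (pm s)"
  shows "hm w (shift d s) \<le> hm w s"
proof -
  obtain jl jr where h: "window s jl jr" "cnt w s jl jr = hm w s" using hm_attained[OF assms(1)] .
  have "hm w (shift d s) \<le> cnt w (shift d s) (jl - d) (jr - d)"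
    using window_pm[OF assms(1) h(1)] assms(2,3) h(1)
    by (intro hm_le window_shift) (auto simp: window_def)
  then show ?thesis using h by (simp add: cnt_shift)
qed

lemma hm_split_Nd:
  assumes "valid s" "s 0 = Nd l r"
  shows "hm w (split_at 0 s) + w \<le> hm w s"
proof -
  obtain jl jr where h: "window s jl jr" "cnt w s jl jr = hm w s" using hm_attained[OF assms(1)] .
  have b: "jl \<le> 0" "0 \<le> jr" using h by (auto simp: window_def)
  show ?thesis
    using cnt_split_at[OF b, of w s] hm_le[OF window_split_at[OF h(1) b], of w] h(2) assms(2) by simp
qed

lemma hm_join_sib:
  assumes "valid s" "sib (s 0) (s 1)"
  shows "hm w (join_at 0 s) + 1 \<le> hm w s"
proof -
  obtain jl jr where h: "window s jl jr" "cnt w s jl jr = hm w s" using hm_attained[OF assms(1)] .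
  have b: "jl \<le> 0" "0 < jr" using h(1) obj_window(3)[OF h(1), of 0] assms(2) by (auto simp: window_def obj_def)
  show ?thesis
    using cnt_join_at[OF b, of w s] hm_le[OF window_join_at[OF h(1) b b(2)], of w] h(2) wt_sib[OF assms(2), of w]
      assms(2) by (simp add: wt_join)
qed

text \<open>Removing a caret keeps the number of leaves, so descent is measured with carets
  included; moving the pointer is measured by the distance to the target.\<close>

definition parent_less :: "(state \<times> state) set" where
  "parent_less = measures [hm 1, \<lambda>s. nat \<bar>pm s\<bar>]"

lemma wf_parent_less: "wf parent_less"
  unfolding parent_less_def by (rule wf_measures)

lemma parent:
  assumes "valid s" "s \<noteq> init"
  shows "(ap s (dirn s), s) \<in> parent_less" "hm 0 (ap s (dirn s)) \<le> hm 0 s"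
proof -
  consider "pm s < 0" | "pm s > 0" | l r where "pm s = 0" "s 0 = Nd l r"
    | "pm s = 0" "sib (s 0) (s 1)" "\<nexists>l r. s 0 = Nd l r"
    using not_init_pm_0[OF assms] by (fastforce simp: obj_def)
  then have "(ap s (dirn s), s) \<in> parent_less \<and> hm 0 (ap s (dirn s)) \<le> hm 0 s"
  proof cases
    case 1
    then show ?thesis using hm_shift_towards_pm[OF assms(1), of "-1" 0] hm_shift_towards_pm[OF assms(1), of "-1" 1]
      by (auto simp: dirn_def parent_less_def pm_shift[OF assms(1)])
  next
    case 2
    then show ?thesis using hm_shift_towards_pm[OF assms(1), of "1" 0] hm_shift_towards_pm[OF assms(1), of "1" 1]
      by (auto simp: dirn_def parent_less_def pm_shift[OF assms(1)])
  next
    case 3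
    then show ?thesis using hm_split_Nd[OF assms(1), of l r 0] hm_split_Nd[OF assms(1), of l r 1]
      by (auto simp: dirn_def parent_less_def)
  next
    case 4
    then show ?thesis using hm_join_sib[OF assms(1), of 0] hm_join_sib[OF assms(1), of 1]
      by (auto simp: dirn_def parent_less_def)
  qed
  then show "(ap s (dirn s), s) \<in> parent_less" "hm 0 (ap s (dirn s)) \<le> hm 0 s" by auto
qed

text \<open>One end of the edge is the parent of the other; the tests against \<open>init\<close>
  express that the root has no parent.\<close>

definition tree_edge :: "state \<Rightarrow> gen \<Rightarrow> bool" where
  "tree_edge s x \<longleftrightarrow> s \<noteq> init \<and> dirn s = (x, True)
     \<or> ap s (x, True) \<noteq> init \<and> dirn (ap s (x, True)) = (x, False)"

lemma pm_init: "pm init = 0"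
  by (rule pm_eqI[OF valid_init]) (auto simp: target_def init_def obj_def)

text \<open>Along the edge the target index changes from p to p + 1. Either p < 0 or p + 1 > 0, so
  from one of the ends the step towards the target is this edge.\<close>

lemma tree_edge_x0:
  assumes "valid s"
  shows "tree_edge s x0"
proof (cases "pm s < 0")
  case True
  then show ?thesis by (auto simp: tree_edge_def dirn_def pm_init)
next
  case False
  then have "pm (shift (-1) s) > 0" by (simp add: pm_shift[OF assms])
  then show ?thesis unfolding tree_edge_def using pm_init by (auto simp: dirn_def)
qed

text \<open>A caret at the pointer is the target of \<open>s\<close>. If there is a leaf instead,
  splitting it creates a sibling pair, which is the target of the split state.\<close>

lemma tree_edge_x1:
  assumes "valid s" "\<And>i. 1 \<le> i \<Longrightarrow> \<not> obj s i"
  shows "tree_edge s x1"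
proof (cases "s 0")
  case (Nd l r)
  have "pm s = 0"
    by (rule pm_eqI[OF assms(1)]) (use assms(2) Nd in \<open>auto simp: target_def obj_def\<close>)
  moreover have "s \<noteq> init" using Nd by (auto simp: init_def)
  ultimately show ?thesis using Nd by (auto simp: tree_edge_def dirn_def)
next
  case (Lf a k)
  let ?s = "split_at 0 s"
  have "sib (?s 0) (?s 1)" using Lf by (simp add: split_at_def)
  then have o: "obj ?s 0" by (simp add: obj_def)
  have "\<not> obj ?s i" if "1 \<le> i" for i
  proof (cases "i = 1")
    case True
    \<comment> \<open>The tree at index 1 is now a right half; its numerator is odd, so it is not
      the left member of a sibling pair.\<close>
    then show ?thesis using Lf by (cases "s 1") (auto simp: obj_def split_at_def)
  next
    case False
    then show ?thesis using assms(2)[of "i - 1"] that by (auto simp: obj_def split_at_def)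
  qed
  then have "pm ?s = 0"
    by (intro pm_eqI valid_split_at assms(1)) (use o in \<open>auto simp: target_def\<close>)
  moreover have "?s \<noteq> init" using Lf by (auto simp: init_def split_at_def fun_eq_iff intro!: exI[of _ 0])
  moreover have "\<nexists>l r. ?s 0 = Nd l r" using Lf by (simp add: split_at_def)
  ultimately show ?thesis by (auto simp: tree_edge_def dirn_def)
qed

lemma not_tree_edge_x1:
  assumes "valid s" "\<not> tree_edge s x1"
  shows "1 \<le> pm s" "obj s (pm s)" "\<And>i. pm s < i \<Longrightarrow> \<not> obj s i"
proof -
  obtain i where "1 \<le> i" "obj s i" using tree_edge_x1[OF assms(1)] assms(2) by blast
  then have "obj s (pm s) \<and> (\<forall>j>pm s. \<not> obj s j)" using target_pm[OF assms(1)] by (auto simp: target_def)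
  moreover then have "i \<le> pm s" using \<open>obj s i\<close> by (meson not_le)
  ultimately show "1 \<le> pm s" "obj s (pm s)" "\<And>i. pm s < i \<Longrightarrow> \<not> obj s i" using \<open>1 \<le> i\<close> by auto
qed

lemma tree_edge_shift_x1:
  assumes "valid s" "pm s \<le> d"
  shows "tree_edge (shift d s) x1"
proof (rule ccontr)
  assume "\<not> ?thesis"
  from not_tree_edge_x1(1)[OF valid_shift[OF assms(1)] this] show False
    using assms by (simp add: pm_shift)
qed

text \<open>An \<open>x1\<close>-edge is represented by its unsplit end. Merging siblings lowers the
  first component, moving the pointer past trees lowers the second, splitting the target tree lowers
  the second or third, and joining trees 1 and 2 lowers the fourth if no earlier one.\<close>

definition edge_less :: "(state \<times> state) set" where
  "edge_less = measures [\<lambda>s. hm 0 (split_at 0 s), \<lambda>s. \<Sum>i\<in>{1..pm s}. wt 0 (s i), \<lambda>s. wt 0 (s (pm s)), nat \<circ> pm]"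

lemma wf_edge_less: "wf edge_less"
  unfolding edge_less_def by (rule wf_measures)

lemma target_obj: "obj s p \<Longrightarrow> (\<And>i. p < i \<Longrightarrow> \<not> obj s i) \<Longrightarrow> target s p"
  by (auto simp: target_def)

text \<open>If the new target is the right child, the sum is unchanged but the target tree has lost
  leaves. If it is at a smaller index, the leaves of the right child have left the sum.\<close>

lemma edge_less_split_Nd:
  assumes "valid s" "1 \<le> pm s" "s (pm s) = Nd l r" "\<And>i. pm s < i \<Longrightarrow> \<not> obj s i"
    and le: "hm 0 (split_at 0 (split_at (pm s) s)) \<le> hm 0 (split_at 0 s)"
  shows "tree_edge (split_at (pm s) s) x1 \<or> (split_at (pm s) s, s) \<in> edge_less"
proof (rule HOL.disj_imp[THEN iffD2, rule_format])
  define P where "P = pm s"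
  define b where "b = split_at P s"
  assume nt: "\<not> tree_edge (split_at (pm s) s) x1"
  have v: "valid b" unfolding b_def by (rule valid_split_at[OF assms(1)])
  have pb: "1 \<le> pm b" "obj b (pm b)" using not_tree_edge_x1[OF v] nt by (auto simp: b_def P_def)
  have "\<not> obj b i" if "P + 1 < i" for i
    using assms(4)[of "i - 1"] that by (auto simp: obj_def b_def split_at_def P_def)
  then have le1: "pm b \<le> P + 1" using pb(2) by (meson not_le)
  have bl: "b P = l" "b (P + 1) = r" "\<And>i. i < P \<Longrightarrow> b i = s i" 
    using assms(3) by (auto simp: b_def P_def split_at_def)
  have "{1..P} = insert P {1..P - 1}" "{1..P + 1} = insert (P + 1) (insert P {1..P - 1})"
    using assms(2) by (auto simp: P_def)
  moreover have "(\<Sum>i\<in>{1..P - 1}. wt 0 (b i)) = (\<Sum>i\<in>{1..P - 1}. wt 0 (s i))"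
    by (rule sum.cong) (auto simp: bl)
  ultimately have S: "(\<Sum>i\<in>{1..P}. wt 0 (s i)) = (\<Sum>i\<in>{1..P - 1}. wt 0 (s i)) + wt 0 l + wt 0 r"
    "(\<Sum>i\<in>{1..P}. wt 0 (b i)) = (\<Sum>i\<in>{1..P - 1}. wt 0 (s i)) + wt 0 l"
    "(\<Sum>i\<in>{1..P + 1}. wt 0 (b i)) = (\<Sum>i\<in>{1..P - 1}. wt 0 (s i)) + wt 0 l + wt 0 r"
    using assms(3) by (auto simp: bl simp flip: P_def)
  show "(split_at (pm s) s, s) \<in> edge_less"
  proof (cases "pm b = P + 1")
    case True
    then show ?thesis using le S assms(3) wt_pos[of 0 l] 
      by (auto simp: edge_less_def bl simp flip: b_def P_def)
  next
    case False
    then have "(\<Sum>i\<in>{1..pm b}. wt 0 (b i)) \<le> (\<Sum>i\<in>{1..P}. wt 0 (b i))"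
      using le1 by (intro sum_mono2) auto
    then have "(\<Sum>i\<in>{1..pm b}. wt 0 (b i)) < (\<Sum>i\<in>{1..P}. wt 0 (s i))"
      using S wt_pos[of 0 r] by linarith
    then show ?thesis using le by (auto simp: edge_less_def simp flip: b_def P_def)
  qed
qed

lemma obj_join_at: "j < i \<Longrightarrow> obj (join_at j s) i \<longleftrightarrow> obj s (i + 1)"
  by (auto simp: obj_def join_at_def)

lemma obj_split_at: "j + 1 < i \<Longrightarrow> obj (split_at j s) i \<longleftrightarrow> obj s (i - 1)"
  by (auto simp: obj_def split_at_def)

text \<open>The join adds no leaves and, as \<open>3 \<le> pm s\<close>, does not touch the target
  tree, which moves one index closer.\<close>

lemma edge_less_join_1_2:
  assumes "valid s" "3 \<le> pm s" "obj s (pm s)" "\<And>i. pm s < i \<Longrightarrow> \<not> obj s i"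
    and le: "hm 0 (split_at 0 (join_at 1 s)) \<le> hm 0 (split_at 0 s)"
  shows "(join_at 1 s, s) \<in> edge_less"
proof -
  define P where "P = pm s"
  have t: "target (join_at 1 s) (P - 1)"
    by (rule target_obj) (use assms in \<open>auto simp: obj_join_at P_def\<close>)
  have pm: "pm (join_at 1 s) = P - 1"
    by (rule pm_eqI[OF valid_join_at[OF assms(1)] t])
  have "{1..P} = insert 1 (insert 2 {3..P})" "{1..P - 1} = insert 1 {2..P - 1}"
    using assms(2) by (auto simp: P_def)
  moreover have "(\<Sum>i\<in>{2..P - 1}. wt 0 (join_at 1 s i)) = (\<Sum>i\<in>{3..P}. wt 0 (s i))"
    by (rule sum.reindex_bij_witness[of _ "\<lambda>i. i - 1" "\<lambda>i. i + 1"]) (auto simp: join_at_def)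
  ultimately have "(\<Sum>i\<in>{1..P}. wt 0 (s i)) = wt 0 (s 1) + (wt 0 (s 2) + (\<Sum>i\<in>{3..P}. wt 0 (s i)))"
    "(\<Sum>i\<in>{1..P - 1}. wt 0 (join_at 1 s i)) = wt 0 (join (s 1) (s 2)) + (\<Sum>i\<in>{3..P}. wt 0 (s i))"
    by (auto simp: join_at_def)
  moreover have "wt 0 (join (s 1) (s 2)) \<le> wt 0 (s 1) + wt 0 (s 2)"
    using wt_pos[of 0 "s 1"] by (auto simp: wt_join)
  moreover have "join_at 1 s (P - 1) = s P" using assms(2) by (simp add: join_at_def P_def)
  ultimately show ?thesis using le assms(2) pm by (auto simp: edge_less_def simp flip: P_def)
qed

text \<open>Trees 1 and 2 disappear from the sum, and each has at least one leaf.\<close>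

lemma edge_less_shift:
  assumes "valid s" "3 \<le> pm s" "obj s (pm s)" "\<And>i. pm s < i \<Longrightarrow> \<not> obj s i"
    and v: "valid b" and b: "\<And>i. 1 \<le> i \<Longrightarrow> b i = s (i + 2)"
    and le: "hm 0 (split_at 0 b) \<le> hm 0 (split_at 0 s)"
  shows "(b, s) \<in> edge_less"
proof -
  define P where "P = pm s"
  have o: "obj b i \<longleftrightarrow> obj s (i + 2)" if "1 \<le> i" for i
    using that by (simp add: obj_def b add.commute)
  have "target b (P - 2)"
    by (rule target_obj) (use assms(2-4) in \<open>auto simp: o P_def\<close>)
  then have pm: "pm b = P - 2" by (rule pm_eqI[OF v])
  have "{1..P} = insert 1 (insert 2 {3..P})"
    using assms(2) by (auto simp: P_def)
  moreover have "(\<Sum>i\<in>{1..P - 2}. wt 0 (b i)) = (\<Sum>i\<in>{3..P}. wt 0 (s i))"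
    by (rule sum.reindex_bij_witness[of _ "\<lambda>i. i - 2" "\<lambda>i. i + 2"]) (auto simp: b)
  ultimately have "(\<Sum>i\<in>{1..P - 2}. wt 0 (b i)) < (\<Sum>i\<in>{1..P}. wt 0 (s i))"
    using wt_pos[of 0 "s 1"] by simp
  then show ?thesis using le assms(2) pm by (auto simp: edge_less_def simp flip: P_def)
qed

section \<open>The state of a group element\<close>

definition st :: "F_elt \<Rightarrow> state" where
  "st g = foldl ap init (rep_F g)"

lemma valid_st [simp]: "valid (st g)"
  unfolding st_def by (rule valid_foldl_ap[OF valid_init])

lemma st_abs_F: "st (abs_F w) = foldl ap init w"
  unfolding st_def by (rule foldl_ap_eqv[OF eqv_rep_F_abs_F valid_init])

lemma st_act [simp]: "st (act g a) = ap (st g) a"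
proof -
  obtain w where "g = abs_F w" by (metis abs_F_rep_F)
  then show ?thesis by (simp add: st_abs_F)
qed

lemma st_actw: "st (actw g w) = foldl ap (st g) w"
  by (induction w arbitrary: g) auto

lemma st_one: "st one_F = init"
  by (simp add: one_F_def st_abs_F)

section \<open>Word length and forest states\<close>

lemma hm_0_st_le: "hm 0 (st g) \<le> wl g + 1"
proof -
  have "hm 0 (foldl ap init w) \<le> length w + 1" for w
  proof (induction w rule: rev_induct)
    case (snoc a w)
    then show ?case using hm_0_ap_le[OF valid_foldl_ap[OF valid_init], of w a] by simp
  qed (simp add: hm_0_init[simplified])
  then show ?thesis using wl_attained[of g] st_abs_F by metis
qed

text \<open>An integer bound lets the budgets below be linear expressions in the window ends, which
  may be negative.\<close>

definition reach :: "state \<Rightarrow> int \<Rightarrow> bool" where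
  "reach s k \<longleftrightarrow> (\<exists>w. int (length w) \<le> k \<and> foldl ap s w = init)"

lemma reach_ap:
  assumes "reach (ap s a) k" "k + 1 \<le> m"
  shows "reach s m"
proof -
  obtain w where w: "int (length w) \<le> k" "foldl ap (ap s a) w = init"
    using assms(1) unfolding reach_def by blast
  show ?thesis unfolding reach_def by (rule exI[of _ "a # w"]) (use w assms(2) in auto)
qed

lemma window_left: "window s jl jr \<Longrightarrow> i < jl \<Longrightarrow> \<exists>a<0. s i = Lf a 0"
  and window_right: "window s jl jr \<Longrightarrow> jr < i \<Longrightarrow> \<exists>a>0. s i = Lf a 0"
  by (auto simp: window_def)

lemma reach_integers: "(\<And>i. s i = Lf (i + c) 0) \<Longrightarrow> \<bar>c\<bar> = int n \<Longrightarrow> reach s (int n)"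
proof (induction n arbitrary: s c)
  case 0
  then show ?case by (auto simp: reach_def init_def intro!: exI[of _ "[]"])
next
  case (Suc n)
  show ?case
  proof (cases "c > 0")
    case True
    have "reach (shift (-1) s) (int n)" by (rule Suc.IH[of _ "c - 1"]) (use Suc.prems True in \<open>auto simp: shift_def\<close>)
    then show ?thesis by (intro reach_ap[of s "(x0, True)"]) auto
  next
    case False
    have "reach (shift 1 s) (int n)" by (rule Suc.IH[of _ "c + 1"]) (use Suc.prems False in \<open>auto simp: shift_def\<close>)
    then show ?thesis by (intro reach_ap[of s "(x0, False)"]) auto
  qed
qed

lemma reach_mono: "reach s k \<Longrightarrow> k \<le> m \<Longrightarrow> reach s m"
  unfolding reach_def by force

text \<open>Merge sibling leaves while sweeping the pointer to the left.\<close>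
lemma reach_leaves:
  assumes "valid s" "window s jl jr" "\<And>i. \<exists>a k. s i = Lf a k" "\<And>i. 1 \<le> i \<Longrightarrow> \<not> obj s i"
    "jr - 2 * jl = int n"
  shows "reach s (int n)"
  using assms
proof (induction n arbitrary: s jl jr rule: less_induct)
  case (less n)
  note v = \<open>valid s\<close> and w = \<open>window s jl jr\<close>
  have b: "jl \<le> 0" "0 \<le> jr" using w by (auto simp: window_def)
  show ?case
  \<comment> \<open>The budget \<open>jr - 2 * jl\<close> drops by exactly one per letter: a merge
    lowers \<open>jr\<close>, and a step to the left raises both window ends.\<close>
  proof (cases "obj s 0")
    case True
    then have s: "sib (s 0) (s 1)" using less.prems(3)[of 0] by (auto simp: obj_def)
    then have jr: "0 < jr" using obj_window(3)[OF w True] by simp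
    have "reach (join_at 0 s) (int (n - 1))"
    proof (rule less.IH[OF _ valid_join_at[OF v] window_join_at[OF w b(1) jr jr]])
      show "\<exists>a k. join_at 0 s i = Lf a k" for i
        using less.prems(3) s by (auto simp: join_at_def join_def elim!: sibE)
      show "\<not> obj (join_at 0 s) i" if "1 \<le> i" for i
        using less.prems(4)[of "i + 1"] that by (simp add: obj_join_at)
    qed (use less.prems(5) b jr in auto)
    then show ?thesis using less.prems(5) b jr by (intro reach_ap[of s "(x1, False)"]) auto
  next
    case no0: False
    show ?thesis
    proof (cases "jl = 0")
      case True
      have "\<not> obj s i" for i
        using less.prems(4)[of i] no0 obj_window(1)[OF w, of i] True by (cases "i \<ge> 1"; cases "i = 0") auto
      then obtain c where c: "\<And>i. s i = Lf (i + c) 0" using no_obj_imp_integers[OF v] by metis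
      \<comment> \<open>The leaves next to the window give \<open>- jr \<le> c\<close> and
        \<open>c \<le> 0\<close>, so at most \<open>jr\<close> further steps remain.\<close>
      have "-1 + c < 0" using window_left[OF w, of "-1"] True c[of "-1"] by auto
      moreover have "jr + 1 + c > 0" using window_right[OF w, of "jr + 1"] c[of "jr + 1"] by auto
      ultimately show ?thesis
        using less.prems(5) True reach_integers[OF c, of "nat \<bar>c\<bar>"] by (auto elim!: reach_mono)
    next
      case False
      have "reach (shift (-1) s) (int (n - 1))"
      proof (rule less.IH[OF _ valid_shift[OF v] window_shift[OF w]])
        show "\<exists>a k. shift (-1) s i = Lf a k" for i
          using less.prems(3) by (auto simp: shift_def)
        show "\<not> obj (shift (-1) s) i" if "1 \<le> i" for i
          using less.prems(4)[of "i - 1"] that no0 by (cases "i = 1") auto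
      qed (use less.prems(5) b False in auto)
      then show ?thesis using less.prems(5) b False by (intro reach_ap[of s "(x0, True)"]) auto
    qed
  qed
qed

lemma cnt_ge: "0 \<le> jr + 1 \<Longrightarrow> jr + 1 \<le> int (cnt w s 0 jr)"
proof -
  assume a: "0 \<le> jr + 1"
  have "card {0..jr} = (\<Sum>i\<in>{0..jr}. 1)" by simp
  also have "\<dots> \<le> cnt w s 0 jr" unfolding cnt_def by (rule sum_mono) (use wt_pos in \<open>simp add: Suc_le_eq\<close>)
  finally show ?thesis using a by simp
qed

text \<open>Dismantle all trees while sweeping the pointer to the right.\<close>
lemma reach_dismantle:
  assumes "valid s" "window s jl jr" "\<And>i. i < 0 \<Longrightarrow> \<exists>a k. s i = Lf a k"
    "4 * int (cnt 0 s 0 jr) - 4 - 2 * jl - jr = int n"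
  shows "reach s (int n)"
  using assms
proof (induction n arbitrary: s jl jr rule: less_induct)
  case (less n)
  note v = \<open>valid s\<close> and w = \<open>window s jl jr\<close>
  have b: "jl \<le> 0" "0 \<le> jr" using w by (auto simp: window_def)
  have pos: "jr + 1 \<le> int (cnt 0 s 0 jr)" by (rule cnt_ge) (use b in simp)
  show ?case
  \<comment> \<open>A split keeps the leaf count and raises \<open>jr\<close>, at cost 1. A step to
    the right passes a leaf, which releases 4; of these, 2 + 1 pay for the shift of the window ends
    and 1 for the letter. At a leaf with \<open>jr = 0\<close> the budget is
    \<open>- 2 * jl\<close>, just what the sweep back needs.\<close>
  proof (cases "s 0")
    case (Nd l r)
    have c: "cnt 0 (split_at 0 s) 0 (jr + 1) = cnt 0 s 0 jr"
      using cnt_split_at[of 0 0 jr 0 s] b Nd by simp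
    have "0 < n"
    proof (rule ccontr)
      assume "\<not> 0 < n"
      then have "jr = 0" "cnt 0 s 0 jr = 1" using less.prems(4) pos b by auto
      then show False using Nd wt_pos[of 0 l] wt_pos[of 0 r] by (simp add: cnt_def)
    qed
    have "reach (split_at 0 s) (int (n - 1))"
      by (rule less.IH[OF _ valid_split_at[OF v] window_split_at[OF w b]])
        (use less.prems(3,4) \<open>0 < n\<close> c in \<open>auto simp: split_at_def\<close>)
    then show ?thesis using \<open>0 < n\<close> by (intro reach_ap[of s "(x1, True)"]) auto
  next
    case (Lf a k)
    show ?thesis
    proof (cases "jr = 0")
      case True
      have "reach s (int (nat (jr - 2 * jl)))"
      proof (rule reach_leaves[OF v w])
        show "\<exists>a k. s i = Lf a k" for i
        proof (cases "i \<le> 0")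
          case True
          then show ?thesis using less.prems(3)[of i] Lf by (cases "i = 0") auto
        next
          case False
          then show ?thesis using window_right[OF w, of i] \<open>jr = 0\<close> by auto
        qed
        show "\<not> obj s i" if "1 \<le> i" for i using obj_window(2)[OF w, of i] True that by auto
      qed (use b in auto)
      then show ?thesis by (rule reach_mono) (use less.prems(4) pos True b in auto)
    next
      case False
      have "{0..jr} = insert 0 {1..jr}" using b by auto
      then have c: "cnt 0 s 0 jr = cnt 0 (shift 1 s) 0 (jr - 1) + 1"
        using cnt_shift[of 0 1 s 1 jr] Lf by (simp add: cnt_def)
      have "0 < n" using less.prems(4) pos b False by auto
      have "reach (shift 1 s) (int (n - 1))"
      proof (rule less.IH[OF _ valid_shift[OF v] window_shift[OF w]])
        show "\<exists>a k. shift 1 s i = Lf a k" if "i < 0" for i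
          using less.prems(3)[of "i + 1"] that Lf by (cases "i = -1") (auto simp: shift_def)
      qed (use \<open>0 < n\<close> b c False less.prems(4) in auto)
      then show ?thesis using \<open>0 < n\<close> by (intro reach_ap[of s "(x0, False)"]) auto
    qed
  qed
qed

lemma reach_shift_left: "reach (shift (- int m) s) k \<Longrightarrow> reach s (k + int m)"
proof (induction m arbitrary: s)
  case (Suc m)
  then have "reach (shift (-1) s) (k + int m)" by (intro Suc.IH) (simp add: add.commute)
  then show ?case by (intro reach_ap[of s "(x0, True)"]) auto
qed simp

text \<open>The pointer first goes to the left end of a smallest window, at cost
  \<open>- jl\<close>; the two sweeps start there.\<close>

lemma reach_hm:
  assumes "valid s"
  shows "reach s (4 * int (hm 0 s))"
proof -
  obtain jl jr where h: "window s jl jr" "cnt 0 s jl jr = hm 0 s" using hm_attained[OF assms(1)] .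
  have b: "jl \<le> 0" "0 \<le> jr" using h by (auto simp: window_def)
  have w: "window (shift jl s) 0 (jr - jl)" using window_shift[OF h(1), of jl] b by simp
  have c: "cnt 0 (shift jl s) 0 (jr - jl) = hm 0 s" using cnt_shift[of 0 jl s jl jr] h(2) by simp
  have p: "jr - jl + 1 \<le> int (cnt 0 (shift jl s) 0 (jr - jl))" by (rule cnt_ge) (use b in simp)
  have "reach (shift jl s) (int (nat (4 * int (hm 0 s) - 4 - (jr - jl))))"
    using p c by (intro reach_dismantle[OF valid_shift[OF assms] w])
      (use w in \<open>auto simp: window_def\<close>)
  then have "reach s (int (nat (4 * int (hm 0 s) - 4 - (jr - jl))) + int (nat (- jl)))"
    using b by (intro reach_shift_left) simp
  then show ?thesis by (rule reach_mono) (use b p c in auto)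
qed

lemma wl_one [simp]: "wl one_F = 0"
  using wl_le[of "[]"] by (simp add: one_F_def)

text \<open>Steering the state to \<open>init\<close> yields a word for the inverse only if
  \<open>init\<close> belongs to the identity alone; \<open>st_eq_init_iff\<close> supplies this
  later.\<close>

lemma wl_le_hm_0:
  assumes "\<And>h. st h = init \<Longrightarrow> h = one_F"
  shows "wl g \<le> 4 * hm 0 (st g)"
proof -
  obtain w where w: "int (length w) \<le> 4 * int (hm 0 (st g))" "foldl ap (st g) w = init"
    using reach_hm[OF valid_st] by (auto simp: reach_def)
  then have "actw g w = one_F" by (intro assms) (simp add: st_actw)
  then show ?thesis using wl_actw_ge[of g w] w(1) by simp
qed

section \<open>The 2-cells filling the edges outside the tree\<close>

lemma hm_shift_le: "window s jl jr \<Longrightarrow> 0 \<le> d \<Longrightarrow> d \<le> jr \<Longrightarrow> hm w (shift d s) \<le> cnt w s jl jr"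
  using hm_le[OF window_shift, of s jl jr d w] by (simp add: cnt_shift window_def)

lemma split_0_join_at: "1 \<le> j \<Longrightarrow> split_at 0 (join_at j s) = join_at (j + 1) (split_at 0 s)"
  by (auto simp: fun_eq_iff split_at_def join_at_def add.commute)

lemma join_at_split_at_comm: "i + 1 < j \<Longrightarrow> join_at j (split_at i s) = split_at i (join_at (j - 1) s)"
  by (auto simp: fun_eq_iff split_at_def join_at_def)

text \<open>Every vertex of the cell used for an edge stays below the split side of the edge.\<close>
lemma hm_cell_split:
  assumes "valid s" "1 \<le> P" "s P = Nd l r"
  defines "n \<equiv> hm 0 (split_at 0 s)"
  shows "\<And>d. 0 \<le> d \<Longrightarrow> d \<le> P \<Longrightarrow> hm 0 (shift d s) \<le> n"
    and "\<And>d. 0 \<le> d \<Longrightarrow> d \<le> P + 1 \<Longrightarrow> hm 0 (shift d (split_at 0 s)) \<le> n"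
    and "\<And>d. 0 \<le> d \<Longrightarrow> d \<le> P \<Longrightarrow> hm 0 (shift d (split_at P s)) \<le> n"
    and "\<And>d. 0 \<le> d \<Longrightarrow> d \<le> P + 1 \<Longrightarrow> hm 0 (shift d (split_at 0 (split_at P s))) \<le> n"
proof -
  define S where "S = split_at 0 s"
  have s: "s = join_at 0 S" using assms(1) by (simp add: S_def)
  obtain jl jr where h: "window S jl jr" "cnt 0 S jl jr = n"
    using hm_attained[OF valid_split_at[OF assms(1), of 0], of 0] by (auto simp: n_def S_def)
  \<comment> \<open>The caret forces a smallest window of the split state to reach
    \<open>P + 1\<close>. Adjusted by joins and by splits of a caret, which add no leaf, this window
    serves for all vertices of the cell.\<close>
  have SP: "S (P + 1) = Nd l r" using assms(2,3) by (auto simp: S_def split_at_def)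
  then have jr: "P + 1 \<le> jr" by (intro obj_window(2)[OF h(1)]) (auto simp: obj_def)
  have jl: "jl \<le> 0" using h(1) by (auto simp: window_def)
  have w: "window s jl (jr - 1)" unfolding s by (rule window_join_at[OF h(1) jl]) (use jr assms(2) in auto)
  have wb: "window (split_at P s) jl jr"
    using window_split_at[OF w, of P] jl jr assms(2) by auto
  have wB: "window (split_at (P + 1) S) jl (jr + 1)"
    using window_split_at[OF h(1), of "P + 1"] jl jr assms(2) by auto
  have c: "cnt 0 s jl (jr - 1) \<le> n"
    using cnt_join_at[of jl 0 jr 0 S] jl jr assms(2) h(2) wt_join[of 0 "S 0" "S 1"] wt_pos[of 0 "S 0"] wt_pos[of 0 "S 1"]
    by (auto simp flip: s split: if_splits)
  have cb: "cnt 0 (split_at P s) jl jr \<le> n"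
    using cnt_split_at[of jl P "jr - 1" 0 s] c jl jr assms(2,3) by auto
  have cB: "cnt 0 (split_at (P + 1) S) jl (jr + 1) \<le> n"
    using cnt_split_at[of jl "P + 1" jr 0 S] h(2) jl jr assms(2) SP by auto
  have B: "split_at 0 (split_at P s) = split_at (P + 1) S"
    unfolding S_def using assms(2) by (intro split_at_split_at) auto
  show "hm 0 (shift d s) \<le> n" if "0 \<le> d" "d \<le> P" for d
    using hm_shift_le[OF w, of d 0] that jr c by auto
  show "hm 0 (shift d (split_at 0 s)) \<le> n" if "0 \<le> d" "d \<le> P + 1" for d
    using hm_shift_le[OF h(1), of d 0] that jr h(2) by (auto simp: S_def)
  show "hm 0 (shift d (split_at P s)) \<le> n" if "0 \<le> d" "d \<le> P" for d
    using hm_shift_le[OF wb, of d 0] that jr cb by auto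
  show "hm 0 (shift d (split_at 0 (split_at P s))) \<le> n" if "0 \<le> d" "d \<le> P + 1" for d
    using hm_shift_le[OF wB, of d 0] that jr cB unfolding B by auto
qed

text \<open>Something simplifiable lies at or beyond the trees to be joined, so a smallest window of
  the split state contains both. Joins add no leaf, and merging siblings loses one, whence the
  strict last part.\<close>

lemma hm_cell_join:
  assumes "valid s" "1 \<le> j" "obj s P" "j < P \<or> j = P \<and> sib (s j) (s (j + 1))"
  defines "n \<equiv> hm 0 (split_at 0 s)"
  shows "\<And>d. 0 \<le> d \<Longrightarrow> d \<le> j \<Longrightarrow> hm 0 (shift d s) \<le> n"
    and "\<And>d. 0 \<le> d \<Longrightarrow> d \<le> j + 1 \<Longrightarrow> hm 0 (shift d (split_at 0 s)) \<le> n"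
    and "\<And>d. 0 \<le> d \<Longrightarrow> d \<le> j \<Longrightarrow> hm 0 (shift d (join_at j s)) \<le> n"
    and "\<And>d. 0 \<le> d \<Longrightarrow> d \<le> j + 1 \<Longrightarrow> hm 0 (shift d (split_at 0 (join_at j s))) \<le> n"
    and "sib (s j) (s (j + 1)) \<Longrightarrow> hm 0 (split_at 0 (join_at j s)) < n"
proof -
  define S where "S = split_at 0 s"
  have s: "s = join_at 0 S" using assms(1) by (simp add: S_def)
  obtain jl jr where h: "window S jl jr" "cnt 0 S jl jr = n"
    using hm_attained[OF valid_split_at[OF assms(1), of 0], of 0] by (auto simp: n_def S_def)
  have Sj: "S (j + 1) = s j" "S (j + 2) = s (j + 1)" using assms(2) by (auto simp: S_def split_at_def add.commute)
  have oS: "obj S (P + 1)" using assms(2,3,4) obj_split_at[of 0 "P + 1" s] by (auto simp: S_def)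
  have jr: "j + 2 \<le> jr" using obj_window(2,3)[OF h(1) oS] assms(4) Sj by (auto simp: algebra_simps)
  have jl: "jl \<le> 0" using h(1) by (auto simp: window_def)
  have w: "window s jl (jr - 1)" unfolding s by (rule window_join_at[OF h(1) jl]) (use jr assms(2) in auto)
  have wb: "window (join_at j s) jl (jr - 2)"
    using window_join_at[OF w, of j] jl jr assms(2) by (auto simp: algebra_simps)
  have wB: "window (join_at (j + 1) S) jl (jr - 1)"
    using window_join_at[OF h(1), of "j + 1"] jl jr assms(2) by auto
  have c: "cnt 0 s jl (jr - 1) \<le> n"
    using cnt_join_at[of jl 0 jr 0 S] jl jr assms(2) h(2) wt_join[of 0 "S 0" "S 1"] wt_pos[of 0 "S 0"] wt_pos[of 0 "S 1"]
    by (auto simp flip: s split: if_splits)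
  have cb: "cnt 0 (join_at j s) jl (jr - 2) \<le> n"
    using cnt_join_at[of jl j "jr - 1" 0 s] c jl jr assms(2) wt_join[of 0 "s j" "s (j + 1)"]
      wt_pos[of 0 "s j"] wt_pos[of 0 "s (j + 1)"]
    by (auto split: if_splits)
  have cB: "cnt 0 (join_at (j + 1) S) jl (jr - 1) \<le> n
      \<and> (sib (s j) (s (j + 1)) \<longrightarrow> cnt 0 (join_at (j + 1) S) jl (jr - 1) < n)"
    using cnt_join_at[of jl "j + 1" jr 0 S] h(2) jl jr assms(2) wt_join[of 0 "s j" "s (j + 1)"]
      wt_pos[of 0 "s j"] wt_pos[of 0 "s (j + 1)"] wt_sib[of "s j" "s (j + 1)" 0] Sj
    by (auto split: if_splits simp: algebra_simps)
  have B: "split_at 0 (join_at j s) = join_at (j + 1) S"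
    unfolding S_def using assms(2) by (intro split_0_join_at) auto
  show "hm 0 (shift d s) \<le> n" if "0 \<le> d" "d \<le> j" for d
    using hm_shift_le[OF w, of d 0] that jr c by auto
  show "hm 0 (shift d (split_at 0 s)) \<le> n" if "0 \<le> d" "d \<le> j + 1" for d
    using hm_shift_le[OF h(1), of d 0] that jr h(2) by (auto simp: S_def)
  show "hm 0 (shift d (join_at j s)) \<le> n" if "0 \<le> d" "d \<le> j" for d
    using hm_shift_le[OF wb, of d 0] that jr cb by auto
  show "hm 0 (shift d (split_at 0 (join_at j s))) \<le> n" if "0 \<le> d" "d \<le> j + 1" for d
    using hm_shift_le[OF wB, of d 0] that jr cB unfolding B by auto
  show "hm 0 (split_at 0 (join_at j s)) < n" if "sib (s j) (s (j + 1))"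
    using hm_le[OF wB, of 0] cB that unfolding B by auto
qed

section \<open>Boundaries of cells and fillings of edges\<close>

definition cvertex :: "F_elt \<Rightarrow> nat \<Rightarrow> nat \<Rightarrow> F_elt" where
  "cvertex c i j = actw c (take j (rels ! i))"

text \<open>An edge is named by the start of its positive orientation, whichever way the relator
  reads it.\<close>

definition cedge :: "F_elt \<Rightarrow> nat \<Rightarrow> nat \<Rightarrow> F_elt \<times> gen" where
  "cedge c i j = (let h = cvertex c i j; a = rels ! i ! j in (if snd a then h else act h a, fst a))"

definition g_tree :: "F_elt \<times> gen \<Rightarrow> bool" where
  "g_tree e = tree_edge (st (fst e)) (snd e)"

definition g_less :: "((F_elt \<times> gen) \<times> (F_elt \<times> gen)) set" where
  "g_less = inv_image edge_less (st \<circ> fst)"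

lemma wf_g_less: "wf g_less"
  unfolding g_less_def by (intro wf_inv_image wf_edge_less)

text \<open>The second condition drives the inductions. The third makes the split end of
  \<open>e\<close> maximal for N on the boundary, which keeps N from falling when \<open>e\<close>
  is swept onto.\<close>

definition filling :: "F_elt \<times> gen \<Rightarrow> F_elt \<Rightarrow> nat \<Rightarrow> nat \<Rightarrow> bool" where
  "filling e c i k \<longleftrightarrow> i < length rels \<and> k < length (rels ! i) \<and> cedge c i k = e
    \<and> (\<forall>j<length (rels ! i). j \<noteq> k \<longrightarrow> g_tree (cedge c i j) \<or> (cedge c i j, e) \<in> g_less)
    \<and> (\<forall>j<length (rels ! i). hm 0 (st (cvertex c i j)) \<le> hm 0 (st (act (fst e) (snd e, True))))"

lemma rel1_eq: "rel1 = [(x0,True),(x1,False),(x0,False),(x1,True),(x0,True),(x1,True),(x0,False),(x0,False),(x1,False),(x0,True)]"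
  by (simp add: rel1_def comm_def winv_def linv_def)

lemma rel2_eq: "rel2 = [(x0,True),(x1,False),(x0,False),(x0,False),(x1,True),(x0,True),(x0,True),
    (x1,True),(x0,False),(x0,False),(x0,False),(x1,False),(x0,True),(x0,True)]"
  by (simp add: rel2_def comm_def winv_def linv_def)

lemma g_tree_x0: "g_tree (h, x0)"
  by (simp add: g_tree_def tree_edge_x0)

lemmas cell_simps = cvertex_def cedge_def Let_def rels_def rel1_eq rel2_eq g_tree_x0 numeral_eq_Suc All_less_Suc2

text \<open>The cell of \<open>rel1\<close> is the square of two commuting splits. It reads
  \<open>e\<close> backwards as letter 1; the two sides that split tree 1 have their target at the
  pointer and lie in the tree, and the side opposite to \<open>e\<close> starts at
  \<open>split_at 1 s\<close>.\<close>

lemma filling_split_1: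
  assumes "pm (st g) = 1" "st g 1 = Nd l r" "\<And>i. 1 < i \<Longrightarrow> \<not> obj (st g) i"
  shows "filling (g, x1) (act (act g (x1, True)) (x0, False)) 0 1"
proof -
  define s where "s = st g"
  have v: "valid s" by (simp add: s_def)
  have pm: "pm s = 1" using assms(1) by (simp add: s_def)
  note B = hm_cell_split[OF v, of 1 l r, simplified, OF assms(2)[folded s_def]]
  have t1: "tree_edge (shift 1 s) x1" by (rule tree_edge_shift_x1[OF v]) (simp add: pm)
  have "obj (split_at 0 s) 2" using assms(2) by (simp add: obj_def split_at_def flip: s_def)
  then have "target (split_at 0 s) 2"
    by (rule target_obj) (use assms(3) in \<open>simp add: obj_split_at flip: s_def\<close>)
  then have "pm (split_at 0 s) = 2" by (rule pm_eqI[OF valid_split_at[OF v]])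
  then have t2: "tree_edge (shift 2 (split_at 0 s)) x1" by (intro tree_edge_shift_x1 valid_split_at v) simp
  have t3: "tree_edge (split_at 1 s) x1 \<or> (split_at 1 s, s) \<in> edge_less"
    using edge_less_split_Nd[OF v, of l r] B(4)[of 0] assms pm by (simp flip: s_def)
  show ?thesis
    unfolding filling_def
    using t1 t2 t3 B(1)[of 0] B(1)[of 1] B(2)[of 0] B(2)[of 1] B(2)[of 2] B(3)[of 0] B(3)[of 1] B(4)[of 0] B(4)[of 1] B(4)[of 2] v
    by (simp add: cell_simps g_tree_def[of "(_, x1)"] g_less_def split_at_split_at valid_split_at valid_shift flip: s_def)
qed
text \<open>In \<open>rel2\<close> the same square has its second split at distance 2.\<close>

lemma filling_split_2:
  assumes "pm (st g) = 2" "st g 2 = Nd l r" "\<And>i. 2 < i \<Longrightarrow> \<not> obj (st g) i"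
  shows "filling (g, x1) (act (act g (x1, True)) (x0, False)) 1 1"
proof -
  define s where "s = st g"
  have v: "valid s" by (simp add: s_def)
  have pm: "pm s = 2" using assms(1) by (simp add: s_def)
  note B = hm_cell_split[OF v, of 2 l r, simplified, OF assms(2)[folded s_def]]
  have t1: "tree_edge (shift 2 s) x1" by (rule tree_edge_shift_x1[OF v]) (simp add: pm)
  have "obj (split_at 0 s) 3" using assms(2) by (simp add: obj_def split_at_def flip: s_def)
  then have "target (split_at 0 s) 3"
    by (rule target_obj) (use assms(3) in \<open>simp add: obj_split_at flip: s_def\<close>)
  then have "pm (split_at 0 s) = 3" by (rule pm_eqI[OF valid_split_at[OF v]])
  then have t2: "tree_edge (shift 3 (split_at 0 s)) x1" by (intro tree_edge_shift_x1 valid_split_at v) simp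
  have t3: "tree_edge (split_at 2 s) x1 \<or> (split_at 2 s, s) \<in> edge_less"
    using edge_less_split_Nd[OF v, of l r] B(4)[of 0] assms pm by (simp flip: s_def)
  show ?thesis
    unfolding filling_def
    using t1 t2 t3 B(1)[of 0] B(1)[of 1] B(1)[of 2] B(2)[of 0] B(2)[of 1] B(2)[of 2] B(2)[of 3] B(3)[of 0] B(3)[of 1] B(3)[of 2] B(4)[of 0] B(4)[of 1] B(4)[of 2] B(4)[of 3] v
    by (simp add: cell_simps g_tree_def[of "(_, x1)"] g_less_def split_at_split_at valid_split_at valid_shift flip: s_def)
qed
text \<open>Now \<open>e\<close> is the other long side of the square, read as letter 5, and the
  opposite side starts from the forest with the siblings merged. The base results from undoing the
  first five letters.\<close>

lemma filling_sib_1: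
  assumes "pm (st g) = 1" "sib (st g 1) (st g 2)" "\<And>i. 1 < i \<Longrightarrow> \<not> obj (st g) i"
  shows "filling (g, x1) (actw g [(x0,False),(x1,False),(x0,True),(x1,True),(x0,False)]) 0 5"
proof -
  define s where "s = st g"
  have v: "valid s" by (simp add: s_def)
  have pm: "pm s = 1" using assms(1) by (simp add: s_def)
  have sb: "sib (s 1) (s 2)" using assms(2) by (simp add: s_def)
  have o: "obj s 1" using sb by (simp add: obj_def)
  note B = hm_cell_join[OF v, of 1 1, simplified, OF o sb]
  have no: "\<not> obj (join_at 0 (shift 1 s)) i" if "1 \<le> i" for i
    using assms(3)[of "i + 2"] that by (simp add: obj_join_at add.commute flip: s_def)
  have t1: "tree_edge (join_at 0 (shift 1 s)) x1"
    by (rule tree_edge_x1[OF valid_join_at[OF valid_shift[OF v]] no])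
  have no: "\<not> obj (join_at 0 (shift 2 (split_at 0 s))) i" if "1 \<le> i" for i
    using assms(3)[of "i + 2"] that by (simp add: obj_join_at obj_split_at add.commute flip: s_def del: shift_split_at)
  have t2: "tree_edge (join_at 0 (shift 2 (split_at 0 s))) x1"
    by (rule tree_edge_x1[OF valid_join_at[OF valid_shift[OF valid_split_at[OF v]]] no])
  have t3: "(join_at 1 s, s) \<in> edge_less"
    using B(5) by (simp add: edge_less_def)
  show ?thesis
    unfolding filling_def
    using t1 t2 t3 B(1)[of 0] B(1)[of 1] B(2)[of 0] B(2)[of 1] B(2)[of 2] B(3)[of 0] B(3)[of 1] B(4)[of 0] B(4)[of 1] B(4)[of 2] v
    by (simp add: cell_simps g_tree_def[of "(_, x1)"] g_less_def join_at_split_at_comm flip: s_def)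
qed

text \<open>The same with \<open>rel2\<close>, where \<open>e\<close> is letter 7.\<close>

lemma filling_sib_2:
  assumes "pm (st g) = 2" "sib (st g 2) (st g 3)" "\<And>i. 2 < i \<Longrightarrow> \<not> obj (st g) i"
  shows "filling (g, x1) (actw g [(x0,False),(x0,False),(x1,False),(x0,True),(x0,True),(x1,True),(x0,False)]) 1 7"
proof -
  define s where "s = st g"
  have v: "valid s" by (simp add: s_def)
  have pm: "pm s = 2" using assms(1) by (simp add: s_def)
  have sb: "sib (s 2) (s 3)" using assms(2) by (simp add: s_def)
  have o: "obj s 2" using sb by (simp add: obj_def)
  note B = hm_cell_join[OF v, of 2 2, simplified, OF o sb]
  have no: "\<not> obj (join_at 0 (shift 2 s)) i" if "1 \<le> i" for i
    using assms(3)[of "i + 3"] that by (simp add: obj_join_at add.commute flip: s_def)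
  have t1: "tree_edge (join_at 0 (shift 2 s)) x1"
    by (rule tree_edge_x1[OF valid_join_at[OF valid_shift[OF v]] no])
  have no: "\<not> obj (join_at 0 (shift 3 (split_at 0 s))) i" if "1 \<le> i" for i
    using assms(3)[of "i + 3"] that by (simp add: obj_join_at obj_split_at add.commute flip: s_def del: shift_split_at)
  have t2: "tree_edge (join_at 0 (shift 3 (split_at 0 s))) x1"
    by (rule tree_edge_x1[OF valid_join_at[OF valid_shift[OF valid_split_at[OF v]]] no])
  have t3: "(join_at 2 s, s) \<in> edge_less"
    using B(5) by (simp add: edge_less_def)
  show ?thesis
    unfolding filling_def
    using t1 t2 t3 B(1)[of 0] B(1)[of 1] B(1)[of 2] B(2)[of 0] B(2)[of 1] B(2)[of 2] B(2)[of 3] B(3)[of 0] B(3)[of 1] B(3)[of 2] B(4)[of 0] B(4)[of 1] B(4)[of 2] B(4)[of 3] v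
    by (simp add: cell_simps g_tree_def[of "(_, x1)"] g_less_def join_at_split_at_comm flip: s_def)
qed

text \<open>Joining trees 1 and 2 brings the target one index closer on the opposite side. On the
  two sides that perform this join, these trees are at the pointer and no longer to its
  right.\<close>

lemma filling_far:
  assumes "3 \<le> pm (st g)" "obj (st g) (pm (st g))" "\<And>i. pm (st g) < i \<Longrightarrow> \<not> obj (st g) i"
  shows "filling (g, x1) (actw g [(x0,False),(x1,False),(x0,True),(x1,True),(x0,False)]) 0 5"
proof -
  define s where "s = st g"
  have v: "valid s" by (simp add: s_def)
  note a = assms[folded s_def]
  note B = hm_cell_join[OF v _ a(2), of 1, simplified]
  note C = B(1)[of 0] B(1)[of 1] B(2)[of 0] B(2)[of 1] B(2)[of 2] B(3)[of 0] B(3)[of 1] B(4)[of 0] B(4)[of 1] B(4)[of 2]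
  have t1: "(join_at 0 (shift 1 s), s) \<in> edge_less"
  proof (rule edge_less_shift[OF v a])
    show "hm 0 (split_at 0 (join_at 0 (shift 1 s))) \<le> hm 0 (split_at 0 s)"
      using a(1) B(1)[of 1] by simp
    show "valid (join_at 0 (shift 1 s))" by (intro valid_join_at valid_shift v)
  qed (auto simp: join_at_def shift_def add.commute)
  have t2: "(join_at 0 (shift 2 (split_at 0 s)), s) \<in> edge_less"
  proof (rule edge_less_shift[OF v a])
    show "hm 0 (split_at 0 (join_at 0 (shift 2 (split_at 0 s)))) \<le> hm 0 (split_at 0 s)"
      using a(1) B(2)[of 2] by simp
    show "valid (join_at 0 (shift 2 (split_at 0 s)))"
      by (intro valid_join_at valid_shift valid_split_at v)
  qed (auto simp: join_at_def shift_def split_at_def add.commute)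
  have t3: "(join_at 1 s, s) \<in> edge_less"
    by (rule edge_less_join_1_2[OF v a]) (use a(1) B(4)[of 0] in auto)
  show ?thesis
    unfolding filling_def
    using t1 t2 t3 C a(1) v
    by (simp add: cell_simps g_tree_def[of "(_, x1)"] g_less_def join_at_split_at_comm flip: s_def)
qed

lemma filling_ex:
  assumes "\<not> g_tree e"
  shows "\<exists>c i k. filling e c i k"
proof -
  obtain g where e: "e = (g, x1)" using assms g_tree_x0 by (metis gen.exhaust surj_pair)
  define s where "s = st g"
  have v: "valid s" by (simp add: s_def)
  have "\<not> tree_edge s x1" using assms by (simp add: e g_tree_def s_def)
  note p = not_tree_edge_x1[OF v this]
  consider "3 \<le> pm s" | l r where "pm s = 1" "s 1 = Nd l r" | "pm s = 1" "sib (s 1) (s 2)"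
    | l r where "pm s = 2" "s 2 = Nd l r" | "pm s = 2" "sib (s 2) (s 3)"
    using p(1,2) by (cases "pm s = 1"; cases "pm s = 2") (auto simp: obj_def)
  then show ?thesis
    unfolding e
  proof cases
    case 1
    then show "\<exists>c i k. filling (g, x1) c i k" using filling_far[of g] p by (auto simp: s_def)
  next
    case 2
    then show "\<exists>c i k. filling (g, x1) c i k" using filling_split_1[of g] p by (force simp: s_def)
  next
    case 3
    then show "\<exists>c i k. filling (g, x1) c i k" using filling_sib_1[of g] p by (force simp: s_def)
  next
    case 4
    then show "\<exists>c i k. filling (g, x1) c i k" using filling_split_2[of g] p by (force simp: s_def)
  next
    case 5
    then show "\<exists>c i k. filling (g, x1) c i k" using filling_sib_2[of g] p by (force simp: s_def)
  qed
qed

section \<open>States determine elements\<close>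

definition parF :: "F_elt \<Rightarrow> F_elt" where
  "parF g = act g (dirn (st g))"

text \<open>The chain of parents ends at an element with state \<open>init\<close>. Whether this is
  the identity is the question of faithfulness.\<close>

function root :: "F_elt \<Rightarrow> F_elt" where
  "root g = (if st g = init then g else root (parF g))"
  by pat_completeness auto
termination
  by (relation "inv_image parent_less st") (auto simp: wf_parent_less parF_def parent)

declare root.simps [simp del]

lemma root_g_tree:
  assumes "g_tree (h, y)"
  shows "root (act h (y, True)) = root h"
  using assms root.simps[of h] root.simps[of "act h (y, True)"]
  by (auto simp: g_tree_def tree_edge_def parF_def)

lemma cvertex_Suc:
  "j < length (rels ! i) \<Longrightarrow> cvertex c i (Suc j) = act (cvertex c i j) (rels ! i ! j)"
  by (simp add: cvertex_def take_Suc_conv_app_nth actw_append)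

lemma cvertex_0: "cvertex c i 0 = c"
  by (simp add: cvertex_def)

lemma cvertex_length: "i < length rels \<Longrightarrow> cvertex c i (length (rels ! i)) = c"
  by (simp add: cvertex_def actw_rel)

lemma cedge_ends:
  assumes "j < length (rels ! i)" "cedge c i j = (h, y)"
  shows "rels ! i ! j = (y, True) \<and> h = cvertex c i j \<and> act h (y, True) = cvertex c i (Suc j)
    \<or> rels ! i ! j = (y, False) \<and> h = cvertex c i (Suc j) \<and> act h (y, True) = cvertex c i j"
  using assms by (cases "rels ! i ! j") (auto simp: cedge_def cvertex_Suc Let_def split: if_splits)

text \<open>The rest of the boundary of a filling cell joins the two ends of \<open>e\<close> by
  tree edges and smaller edges, and induction makes \<open>root\<close> constant along it.\<close>

lemma root_edge: "root (act (fst e) (snd e, True)) = root (fst e)"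
proof (induction e rule: wf_induct_rule[OF wf_g_less])
  case (1 e)
  show ?case
  proof (cases "g_tree e")
    case True
    then show ?thesis using root_g_tree[of "fst e" "snd e"] by simp
  next
    case False
    then obtain c i k where f: "filling e c i k" using filling_ex by blast
    let ?n = "length (rels ! i)"
    define v where "v = cvertex c i"
    have ik: "i < length rels" "k < ?n" "cedge c i k = e" using f by (auto simp: filling_def)
    have step: "root (v (Suc j)) = root (v j)" if "j < ?n" "j \<noteq> k" for j
    proof -
      obtain h y where e': "cedge c i j = (h, y)" by fastforce
      have "root (act h (y, True)) = root h"
        using f that 1[of "(h, y)"] root_g_tree e' by (auto simp: filling_def)
      then show ?thesis using cedge_ends[OF that(1) e'] by (auto simp: v_def)
    qed
    have a: "root (v j) = root c" if "j \<le> k" for j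
      using that by (induction j) (use step ik in \<open>auto simp: v_def cvertex_0\<close>)
    \<comment> \<open>The loop closes at \<open>c\<close>, so the vertices after side
      \<open>k\<close> are treated backwards from its end.\<close>
    have b: "root (v (?n - j)) = root c" if "j \<le> ?n - Suc k" for j
      using that
    proof (induction j)
      case (Suc j)
      then have "Suc (?n - Suc j) = ?n - j" by simp
      then show ?case using step[of "?n - Suc j"] Suc by auto
    qed (use ik in \<open>auto simp: v_def cvertex_length\<close>)
    have "root (v (Suc k)) = root (v k)" using a[of k] b[of "?n - Suc k"] ik(2) by simp
    moreover obtain g x where "e = (g, x)" by fastforce
    ultimately show ?thesis using cedge_ends[OF ik(2), of c g x] ik(3) by (auto simp: v_def)
  qed
qed

lemma root_eq_one: "root g = one_F"
proof -
  have s: "root (act g a) = root g" for g a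
    using root_edge[of "(g, fst a)"] root_edge[of "(act g a, fst a)"] by (cases a; cases "snd a") auto
  have "root (abs_F w) = one_F" for w
  proof (induction w rule: rev_induct)
    case Nil
    then show ?case using root.simps[of one_F] by (simp add: st_one flip: one_F_def)
  next
    case (snoc a w)
    then show ?case using s[of "abs_F w" a] by simp
  qed
  then show ?thesis by (metis abs_F_rep_F)
qed

text \<open>An element with state \<open>init\<close> is its own root.\<close>

lemma st_eq_init_iff: "st g = init \<longleftrightarrow> g = one_F"
  using root.simps[of g] by (auto simp: root_eq_one st_one)

section \<open>Topology of the Cayley complex\<close>

lemma X1_subset_Xcar: "X1 \<subseteq> Xcar"
  by (auto simp: X1_def Xcar_def)

lemma emap_in_X1: "emap g s t \<in> X1"
  by (auto simp: emap_def X1_def)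

lemma trav_in_X1: "trav h a t \<in> X1"
  by (simp add: trav_def emap_in_X1)

lemma cmap_in_X1: "norm p = 1 \<Longrightarrow> cmap g i p \<in> X1"
  by (simp add: cmap_def Let_def trav_in_X1)

lemma cmap_in_Xcar: "i < length rels \<Longrightarrow> p \<in> cball 0 1 \<Longrightarrow> cmap g i p \<in> Xcar"
  using cmap_in_X1[of p g i] X1_subset_Xcar by (cases "norm p < 1") (auto simp: cmap_def Xcar_def)

lemma X_open_Xcar: "X_open Xcar"
proof -
  have "{t \<in> {0..1}. emap g s t \<in> Xcar} = {0..1}" for g s
    using emap_in_X1 X1_subset_Xcar by auto
  moreover have "{p \<in> cball 0 1. cmap g i p \<in> Xcar} = cball 0 1" if "i < length rels" for g i
    using cmap_in_Xcar[OF that] by auto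
  ultimately show ?thesis by (simp add: X_open_def)
qed

lemma openin_XT: "openin XT U \<longleftrightarrow> X_open U"
  by (simp add: XT_def topology_inverse' istopology_X_open)

lemma topspace_XT: "topspace XT = Xcar"
  unfolding topspace_def openin_XT using X_open_Xcar by (auto simp: X_open_def)

lemma continuous_emap: "continuous_map (top_of_set {0..1}) XT (emap g s)"
  unfolding continuous_map_def topspace_XT openin_XT
  using emap_in_X1 X1_subset_Xcar by (auto simp: X_open_def)

lemma continuous_trav: "continuous_map (top_of_set {0..1}) XT (trav h a)"
proof (cases "snd a")
  case True
  then show ?thesis by (simp add: trav_def[abs_def] continuous_emap)
next
  case False
  have "continuous_map (top_of_set {0..1}) (top_of_set {0..1}) (\<lambda>t::real. 1 - t)"
    by (auto intro!: continuous_intros)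
  from continuous_map_compose[OF this continuous_emap] show ?thesis
    using False by (simp add: trav_def[abs_def] o_def)
qed

lemma continuous_cmap: "i < length rels \<Longrightarrow> continuous_map (top_of_set (cball 0 1)) XT (cmap g i)"
  unfolding continuous_map_def topspace_XT openin_XT
  using cmap_in_Xcar by (auto simp: X_open_def)

lemma ang_cis:
  assumes "0 \<le> \<theta>" "\<theta> < 2 * pi"
  shows "ang (cis \<theta>) = \<theta>"
proof (cases "\<theta> \<le> pi")
  case True
  then have "Arg (cis \<theta>) = \<theta>" using assms by (intro Arg_cis) auto
  then show ?thesis using assms by (simp add: ang_def)
next
  case False
  have "Arg (cis (\<theta> - 2 * pi)) = \<theta> - 2 * pi" using False assms by (intro Arg_cis) auto
  moreover have "cis (\<theta> - 2 * pi) = cis \<theta>" by (simp add: cis_divide[symmetric])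
  ultimately show ?thesis using assms by (simp add: ang_def)
qed

lemma cis_ang: "norm p = 1 \<Longrightarrow> cis (ang p) = p"
proof -
  assume "norm p = 1"
  then have "cis (Arg p) = p" using rcis_cmod_Arg[of p] by (simp add: rcis_def)
  then show ?thesis by (simp add: ang_def cis_mult[symmetric])
qed

lemma ang_bounds: "0 \<le> ang p" "ang p < 2 * pi"
  using Arg_bounded[of p] pi_gt_zero by (auto simp: ang_def)

lemma trav_0 [simp]: "trav h a 0 = V h"
  and trav_1 [simp]: "trav h a 1 = V (act h a)"
  by (cases a; cases "snd a"; simp add: trav_def emap_def)+

text \<open>The boundary circle, parametrised so that side \<open>j\<close> occupies the parameters
  from \<open>j\<close> to \<open>j + 1\<close>.\<close>

definition rim :: "nat \<Rightarrow> real \<Rightarrow> complex" where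
  "rim i x = cis (2 * pi * x / real (length (rels ! i)))"

lemma norm_rim [simp]: "norm (rim i x) = 1"
  by (simp add: rim_def)

lemma continuous_rim: "continuous_on A (rim i)"
proof -
  have "rim i = (\<lambda>x. cis (x * (2 * pi / real (length (rels ! i)))))" by (simp add: rim_def fun_eq_iff mult.commute)
  then show ?thesis by (simp only:) (intro continuous_intros)
qed

lemma cmap_rim_lt:
  assumes "j < length (rels ! i)" "0 \<le> \<tau>" "\<tau> < 1"
  shows "cmap c i (rim i (real j + \<tau>)) = trav (cvertex c i j) (rels ! i ! j) \<tau>"
proof -
  let ?n = "length (rels ! i)"
  have "real j + \<tau> < real ?n" using assms by linarith
  then have "2 * pi * ((real j + \<tau>) / real ?n) < 2 * pi * 1"
    using assms(1) by (intro mult_strict_left_mono) (auto simp: divide_less_eq)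
  then have "ang (rim i (real j + \<tau>)) = 2 * pi * (real j + \<tau>) / real ?n"
    unfolding rim_def using assms by (intro ang_cis) auto
  moreover have "\<lfloor>real j + \<tau>\<rfloor> = int j" using assms by (simp add: floor_eq_iff)
  moreover have "0 < real ?n" using assms by auto
  ultimately show ?thesis by (simp add: cmap_def Let_def cvertex_def)
qed

lemma rim_mod: "0 < length (rels ! i) \<Longrightarrow> rim i (real m + \<tau>) = rim i (real (m mod length (rels ! i)) + \<tau>)"
proof -
  let ?n = "length (rels ! i)"
  assume n: "0 < ?n"
  have "real m = real ?n * real (m div ?n) + real (m mod ?n)"
    by (metis mult.commute of_nat_add of_nat_mult mult_div_mod_eq)
  then have "2 * pi * (real m + \<tau>) / real ?n
      = 2 * pi * (real (m mod ?n) + \<tau>) / real ?n + 2 * pi * real (m div ?n)"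
    using n by (simp add: field_simps)
  moreover have "cis (x + 2 * pi * real k) = cis x" for x k
    using cis_multiple_2pi[of "real k"] by (simp add: cis_mult[symmetric])
  ultimately show ?thesis unfolding rim_def by simp
qed

lemma length_rels_pos: "i < length rels \<Longrightarrow> 0 < length (rels ! i)"
  by (auto simp: rels_def rel1_eq rel2_eq less_Suc_eq)

text \<open>The index \<open>m\<close> may exceed the number of sides, for boundary walks starting
  after an arbitrary side. At \<open>\<tau> = 1\<close> the floor in \<open>cmap\<close> selects the
  next side, which starts at the same vertex.\<close>

lemma cmap_rim:
  assumes "i < length rels" "0 \<le> \<tau>" "\<tau> \<le> 1"
  defines "n \<equiv> length (rels ! i)"
  shows "cmap c i (rim i (real m + \<tau>)) = trav (cvertex c i (m mod n)) (rels ! i ! (m mod n)) \<tau>"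
proof -
  have n: "0 < n" using length_rels_pos[OF assms(1)] by (simp add: n_def)
  have lt: "cmap c i (rim i (real m + \<tau>)) = trav (cvertex c i (m mod n)) (rels ! i ! (m mod n)) \<tau>"
    if "0 \<le> \<tau>" "\<tau> < 1" for m \<tau>
    using rim_mod[of i m \<tau>] cmap_rim_lt[of "m mod n" i \<tau> c] n that by (simp add: n_def)
  show ?thesis
  proof (cases "\<tau> < 1")
    case False
    then have [simp]: "\<tau> = 1" using assms by simp
    have "cvertex c i (Suc m mod n) = cvertex c i (Suc (m mod n))"
      using cvertex_length[OF assms(1)] n by (auto simp: mod_Suc n_def cvertex_0)
    then show ?thesis using lt[of 0 "Suc m"] n by (simp add: cvertex_Suc n_def add.commute)
  qed (use lt assms in auto)
qed

lemma rim_surj: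
  assumes "i < length rels" "norm p = 1"
  obtains j \<tau> where "j < length (rels ! i)" "0 \<le> \<tau>" "\<tau> \<le> 1" "p = rim i (real j + \<tau>)"
proof -
  let ?n = "length (rels ! i)"
  define u where "u = real ?n * ang p / (2 * pi)"
  have n: "0 < ?n" using length_rels_pos[OF assms(1)] .
  have u: "0 \<le> u" "u < real ?n" using ang_bounds[of p] n by (auto simp: u_def field_simps)
  show thesis
  proof (rule that[of "nat \<lfloor>u\<rfloor>" "u - real (nat \<lfloor>u\<rfloor>)"])
    show "nat \<lfloor>u\<rfloor> < ?n" using u by linarith
    show "0 \<le> u - real (nat \<lfloor>u\<rfloor>)" "u - real (nat \<lfloor>u\<rfloor>) \<le> 1" using u by linarith+
    have "2 * pi * u / real ?n = ang p" using n by (simp add: u_def)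
    then show "p = rim i (real (nat \<lfloor>u\<rfloor>) + (u - real (nat \<lfloor>u\<rfloor>)))"
      using cis_ang[OF assms(2)] by (simp add: rim_def)
  qed
qed

text \<open>The weak topology of the graph by itself; \<open>graph_open_extends\<close> identifies
  it with the subspace topology.\<close>

definition graph_open :: "pt set \<Rightarrow> bool" where
  "graph_open W \<longleftrightarrow> W \<subseteq> X1 \<and> (\<forall>g s. openin (top_of_set {0..1::real}) {t \<in> {0..1}. emap g s t \<in> W})"

lemma graph_open_trav:
  assumes "graph_open W"
  shows "openin (top_of_set {0..1}) {t \<in> {0..1}. trav h a t \<in> W}"
proof (cases "snd a")
  case True
  then show ?thesis using assms by (simp add: trav_def graph_open_def)
next
  case False
  let ?S = "{t \<in> {0..1}. emap (act h a) (fst a) t \<in> W}"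
  have "continuous_map (top_of_set {0..1}) (top_of_set {0..1}) (\<lambda>t::real. 1 - t)"
    by (auto intro!: continuous_intros)
  moreover have "openin (top_of_set {0..1}) ?S"
    using assms by (simp add: graph_open_def)
  ultimately have "openin (top_of_set {0..1}) {t \<in> topspace (top_of_set {0..1}). 1 - t \<in> ?S}"
    by (rule openin_continuous_map_preimage)
  moreover have "{t \<in> topspace (top_of_set {0..1}). 1 - t \<in> ?S} = {t \<in> {0..1}. trav h a t \<in> W}"
    using False by (auto simp: trav_def)
  ultimately show ?thesis by simp
qed

lemma compact_diff_openin:
  fixes K S :: "'a::t2_space set"
  assumes "compact K" "openin (top_of_set K) S"
  shows "compact (K - S)"
  using closedin_compact[OF assms(1)] assms(2) by (simp add: closedin_diff)

text \<open>Fatten a graph-open set radially into the 2-cells.\<close>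
lemma graph_open_extends:
  assumes W: "graph_open W"
  obtains U where "openin XT U" "U \<inter> X1 = W"
proof -
  \<comment> \<open>The centre of each disc stays out, having no radial projection.\<close>
  define U where "U = W \<union> {C g i p | g i p. i < length rels \<and> 0 < norm p \<and> norm p < 1 \<and> cmap g i (sgn p) \<in> W}"
  have WX: "W \<subseteq> X1" using W by (simp add: graph_open_def)
  have UX: "U \<inter> X1 = W" using WX by (auto simp: U_def X1_def)
  have "openin (top_of_set {0..1}) {t \<in> {0..1}. emap g s t \<in> U}" for g s
  proof -
    have "{t \<in> {0..1}. emap g s t \<in> U} = {t \<in> {0..1}. emap g s t \<in> W}"
      using UX emap_in_X1 by auto
    then show ?thesis using W by (simp add: graph_open_def)
  qed
  moreover have "openin (top_of_set (cball 0 1)) {p \<in> cball 0 1. cmap g i p \<in> U}" if i: "i < length rels" for g i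
  proof -
    let ?n = "length (rels ! i)"
    let ?T = "\<lambda>j. {0..1} - {t \<in> {0..1}. trav (cvertex g i j) (rels ! i ! j) t \<in> W}"
    define D where "D = {p. norm p = 1 \<and> cmap g i p \<notin> W}"
    \<comment> \<open>The boundary points outside \<open>W\<close> form a finite union of continuous
      images of compact sets, so \<open>D\<close> is closed.\<close>
    have "D = (\<Union>j<?n. (\<lambda>\<tau>. rim i (real j + \<tau>)) ` ?T j)"
    proof (intro equalityI subsetI)
      fix p assume "p \<in> D"
      then have p: "norm p = 1" "cmap g i p \<notin> W" by (auto simp: D_def)
      obtain j \<tau> where j: "j < ?n" "0 \<le> \<tau>" "\<tau> \<le> 1" "p = rim i (real j + \<tau>)" using rim_surj[OF i p(1)] .
      then show "p \<in> (\<Union>j<?n. (\<lambda>\<tau>. rim i (real j + \<tau>)) ` ?T j)"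
        using p(2) cmap_rim[OF i j(2,3), of g j] by (auto intro!: bexI[of _ j] imageI)
    next
      fix p assume "p \<in> (\<Union>j<?n. (\<lambda>\<tau>. rim i (real j + \<tau>)) ` ?T j)"
      then show "p \<in> D" using cmap_rim[OF i, of _ g] by (auto simp: D_def)
    qed
    moreover have "compact ((\<lambda>\<tau>. rim i (real j + \<tau>)) ` ?T j)" for j
      by (intro compact_continuous_image compact_diff_openin graph_open_trav[OF W]
          continuous_on_compose2[OF continuous_rim[of UNIV]] continuous_intros) auto
    ultimately have "closed D" by (simp add: compact_UN compact_imp_closed)
    then have "open (- {0} \<inter> sgn -` (- D))"
      by (intro continuous_open_preimage continuous_intros) auto
    moreover have "{p \<in> cball 0 1. cmap g i p \<in> U} = cball 0 1 \<inter> (- {0} \<inter> sgn -` (- D))"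
    proof (intro set_eqI)
      fix p :: complex
      consider "p = 0" | "p \<noteq> 0" "norm p < 1" | "norm p = 1" | "norm p > 1" by linarith
      then show "p \<in> {p \<in> cball 0 1. cmap g i p \<in> U} \<longleftrightarrow> p \<in> cball 0 1 \<inter> (- {0} \<inter> sgn -` (- D))"
      proof cases
        case 1
        then show ?thesis using WX by (auto simp: cmap_def U_def X1_def)
      next
        case 2
        then show ?thesis using WX i by (auto simp: cmap_def U_def X1_def D_def norm_sgn)
      next
        case 3
        then have "sgn p = p" by (simp add: sgn_div_norm)
        then show ?thesis using 3 UX cmap_in_X1[OF 3] by (auto simp: D_def)
      qed auto
    qed
    ultimately show ?thesis by (simp add: openin_open_Int)
  qed
  moreover have "U \<subseteq> Xcar" using WX X1_subset_Xcar by (auto simp: U_def Xcar_def)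
  ultimately have "openin XT U" by (simp add: openin_XT X_open_def)
  then show thesis using UX that by blast
qed

lemma X1_emap:
  assumes "x \<in> X1"
  obtains g s u where "u \<in> {0..1}" "x = emap g s u"
proof -
  from assms consider g where "x = V g" | g s t where "x = E g s t" "0 < t" "t < 1" by (auto simp: X1_def)
  then show thesis
  proof cases
    case 1
    then show thesis using that[of 0 g x0] by (simp add: emap_def)
  next
    case 2
    then show thesis using that[of t g s] by (simp add: emap_def)
  qed
qed

lemma continuous_map_slice:
  assumes "continuous_map (top_of_set ({0..1} \<times> {0..1})) T (\<lambda>(u, t). q u t)" "u \<in> {0..1::real}"
  shows "continuous_map (top_of_set {0..1::real}) T (q u)"
proof -
  have "continuous_map (top_of_set {0..1}) (top_of_set ({0..1} \<times> {0..1})) (\<lambda>t::real. (u, t))"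
    using assms(2) by (auto intro!: continuous_intros)
  from continuous_map_compose[OF this assms(1)] show ?thesis by (simp add: o_def)
qed

text \<open>The graph carries the quotient topology of a union of closed intervals. Multiplication
  by the unit interval preserves it because the interval is locally compact.\<close>
lemma continuous_map_X1_prod:
  assumes f: "\<And>g s. continuous_map (top_of_set ({0..1} \<times> {0..1})) XT (\<lambda>(u, t). f (emap g s u, t))"
  shows "continuous_map (prod_topology (subtopology XT X1) (top_of_set {0..1::real})) XT f"
proof -
  let ?P = "prod_topology (subtopology XT X1) (top_of_set {0..1::real})"
  have tP: "topspace ?P = X1 \<times> {0..1}" using X1_subset_Xcar by (auto simp: topspace_XT)
  have into: "f (x, t) \<in> Xcar" if xt: "x \<in> X1" "t \<in> {0..1}" for x t
  proof -
    obtain g s u where "u \<in> {0..1}" "x = emap g s u" using X1_emap[OF xt(1)] .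
    moreover have "(\<lambda>(u, t). f (emap g s u, t)) (u, t) \<in> topspace XT"
      by (rule funcset_mem[OF continuous_map_funspace[OF f[of g s]]]) (use xt(2) \<open>u \<in> {0..1}\<close> in simp)
    ultimately show ?thesis by (simp add: topspace_XT)
  qed
  have "openin ?P {z \<in> topspace ?P. f z \<in> U}" if U: "openin XT U" for U
  proof (subst openin_subopen, intro ballI)
    fix z assume z: "z \<in> {z \<in> topspace ?P. f z \<in> U}"
    then obtain x t where xt: "z = (x, t)" "x \<in> X1" "t \<in> {0..1}" "f (x, t) \<in> U" by (auto simp: tP)
    obtain g s u where u: "u \<in> {0..1}" "x = emap g s u" using X1_emap[OF xt(2)] .
    have "continuous_map (top_of_set {0..1}) XT (\<lambda>t. f (x, t))"
      using continuous_map_slice[OF f u(1)] u(2) by simp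
    from openin_continuous_map_preimage[OF this U]
    have "openin (top_of_set {0..1}) {t \<in> {0..1}. f (x, t) \<in> U}" by simp
    then obtain e where e: "e > 0" "cball t e \<inter> {0..1} \<subseteq> {t \<in> {0..1}. f (x, t) \<in> U}"
      using xt(3,4) unfolding openin_contains_cball by blast
    define K where "K = cball t e \<inter> {0..1}"
    have K: "compact K" "K \<subseteq> {0..1}" by (auto simp: K_def)
    \<comment> \<open>Tube argument: on each edge the complement of \<open>W\<close> is the
      projection of a compact set, because \<open>K\<close> is compact.\<close>
    define W where "W = {y \<in> X1. \<forall>t\<in>K. f (y, t) \<in> U}"
    have "openin (top_of_set {0..1}) {r \<in> {0..1}. emap h a r \<in> W}" for h a
    proof -
      let ?A = "{0..1::real} \<times> K"
      let ?O = "{z \<in> ?A. (\<lambda>(u, t). f (emap h a u, t)) z \<in> U}"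
      have "continuous_map (top_of_set ?A) XT (\<lambda>(u, t). f (emap h a u, t))"
        by (rule continuous_map_from_subtopology_mono[OF f]) (use K(2) in auto)
      from openin_continuous_map_preimage[OF this U]
      have "openin (top_of_set ?A) ?O" by simp
      then have "compact (?A - ?O)" by (intro compact_diff_openin compact_Times K(1)) auto
      then have "closed (fst ` (?A - ?O))"
        by (intro compact_imp_closed compact_continuous_image continuous_intros)
      then have "openin (top_of_set {0..1}) ({0..1} \<inter> - fst ` (?A - ?O))"
        by (simp add: openin_open_Int open_Compl)
      moreover have "fst ` (?A - ?O) = {r \<in> {0..1}. \<exists>t\<in>K. f (emap h a r, t) \<notin> U}" (is "?L = ?R")
      proof (intro equalityI subsetI)
        fix r assume "r \<in> ?R"
        then obtain t' where "(r, t') \<in> ?A - ?O" by auto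
        then show "r \<in> ?L" by (rule image_eqI[rotated]) simp
      qed auto
      then have "{0..1} \<inter> - fst ` (?A - ?O) = {r \<in> {0..1}. emap h a r \<in> W}"
        by (auto simp: W_def emap_in_X1)
      ultimately show ?thesis by simp
    qed
    then have "graph_open W" by (auto simp: graph_open_def W_def)
    then obtain U' where U': "openin XT U'" "U' \<inter> X1 = W" by (rule graph_open_extends)
    let ?T = "W \<times> (ball t e \<inter> {0..1})"
    have "openin (subtopology XT X1) W" unfolding openin_subtopology using U' by blast
    moreover have "openin (top_of_set {0..1}) (ball t e \<inter> {0..1})"
      by (metis Int_commute openin_open_Int open_ball)
    ultimately have "openin ?P ?T" by (simp add: openin_prod_Times_iff)
    moreover have "z \<in> ?T" using xt e by (auto simp: W_def K_def)
    moreover have "?T \<subseteq> {z \<in> topspace ?P. f z \<in> U}"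
      unfolding tP by (auto simp: W_def K_def)
    ultimately show "\<exists>T. openin ?P T \<and> z \<in> T \<and> T \<subseteq> {z \<in> topspace ?P. f z \<in> U}" by blast
  qed
  then show ?thesis unfolding continuous_map_def tP topspace_XT using into by auto
qed

section \<open>Gluing and sweeping families of paths\<close>

lemma glue_strips:
  fixes q :: "nat \<Rightarrow> real \<Rightarrow> real \<Rightarrow> 'a"
  assumes n: "0 < n"
    and q: "\<And>j. j < n \<Longrightarrow> continuous_map (top_of_set ({0..1} \<times> {0..1})) T (\<lambda>(u, t). q j u t)"
    and eq: "\<And>j t. Suc j < n \<Longrightarrow> t \<in> {0..1} \<Longrightarrow> q j 1 t = q (Suc j) 0 t"
  obtains F where "continuous_map (top_of_set ({0..real n} \<times> {0..1})) T (\<lambda>(u, t). F u t)"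
    "\<And>j u t. j < n \<Longrightarrow> u \<in> {0..1} \<Longrightarrow> t \<in> {0..1} \<Longrightarrow> F (real j + u) t = q j u t"
proof -
  let ?X = "top_of_set ({0..real n} \<times> {0..1::real})"
  let ?R = "\<lambda>j. {real j..real j + 1} \<times> {0..1::real}"
  let ?f = "\<lambda>j (x, t). q j (x - real j) t"
  have sub: "?R j \<subseteq> {0..real n} \<times> {0..1}" if "j < n" for j using that by auto
  obtain G where G: "continuous_map ?X T G"
    and eqG: "\<And>x i. i \<in> {..<n} \<Longrightarrow> x \<in> topspace ?X \<inter> ?R i \<Longrightarrow> G x = ?f i x"
  proof (rule pasting_lemma_exists_closed[of "{..<n}" ?X ?R T ?f])
    show "finite {..<n}" by simp
    show "topspace ?X \<subseteq> (\<Union>i\<in>{..<n}. ?R i)"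
    proof
      fix z assume "z \<in> topspace ?X"
      then obtain x t where z: "z = (x, t)" "0 \<le> x" "x \<le> real n" "t \<in> {0..1}" by auto
      show "z \<in> (\<Union>i\<in>{..<n}. ?R i)"
      proof (cases "x = real n")
        case True
        then show ?thesis using z n by (intro UN_I[of "n - 1"]) (auto simp: of_nat_diff)
      next
        case False
        then have "nat \<lfloor>x\<rfloor> < n" using z by linarith
        moreover have "real (nat \<lfloor>x\<rfloor>) \<le> x" "x \<le> real (nat \<lfloor>x\<rfloor>) + 1" using z by linarith+
        ultimately show ?thesis using z by (intro UN_I[of "nat \<lfloor>x\<rfloor>"]) auto
      qed
    qed
    show "closedin ?X (?R i)" if "i \<in> {..<n}" for i
      using sub[of i] that by (intro closed_subset closed_Times) auto
    show "continuous_map (subtopology ?X (?R i)) T (?f i)" if "i \<in> {..<n}" for i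
    proof -
      have "continuous_map (top_of_set (?R i)) (top_of_set ({0..1} \<times> {0..1})) (\<lambda>(x, t). (x - real i, t))"
        by (auto simp: case_prod_beta intro!: continuous_intros)
      from continuous_map_compose[OF this q, of i]
      have "continuous_map (top_of_set (?R i)) T (?f i)" using that by (simp add: o_def case_prod_unfold)
      moreover have "subtopology ?X (?R i) = top_of_set (?R i)"
        using sub[of i] that by (simp add: subtopology_subtopology Int_absorb1)
      ultimately show ?thesis by simp
    qed
    show "?f i x = ?f j x" if "i \<in> {..<n}" "j \<in> {..<n}" "x \<in> topspace ?X \<inter> ?R i \<inter> ?R j" for i j x
    proof -
      obtain y t where x: "x = (y, t)" by fastforce
      have *: "?f i x = ?f j x" if "i < j" "j < n" "x \<in> ?R i" "x \<in> ?R j" "t \<in> {0..1}" for i j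
      proof -
        have "j = Suc i" "y = real j" using that unfolding x by auto
        then show ?thesis using eq[of i t] that unfolding x by simp
      qed
      show ?thesis using *[of i j] *[of j i] that x by (cases i j rule: linorder_cases) auto
    qed
  qed (rule that)
  show thesis
  proof (rule that[of "\<lambda>u t. G (u, t)"])
    show "continuous_map ?X T (\<lambda>(u, t). G (u, t))" using G by simp
    show "G (real j + u, t) = q j u t" if "j < n" "u \<in> {0..1}" "t \<in> {0..1}" for j u t
      using eqG[of j "(real j + u, t)"] that by auto
  qed
qed

text \<open>Where the end points agree, a bounded ratio may jump, because it multiplies a difference
  tending to 0. This covers the two ends of a sweep.\<close>

lemma continuous_on_shrinking_segment:
  fixes a b :: "'x::t2_space \<Rightarrow> 'v::real_normed_vector" and r :: "'x \<Rightarrow> real"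
  assumes "continuous_on S a" "continuous_on S b"
    and r: "\<And>x. x \<in> S \<Longrightarrow> 0 \<le> r x \<and> r x \<le> 1"
    and c: "\<And>x. x \<in> S \<Longrightarrow> a x \<noteq> b x \<Longrightarrow> continuous (at x within S) r"
  shows "continuous_on S (\<lambda>x. a x + r x *\<^sub>R (b x - a x))"
  unfolding continuous_on_def
proof
  fix x assume x: "x \<in> S"
  have ab: "(a \<longlongrightarrow> a x) (at x within S)" "(b \<longlongrightarrow> b x) (at x within S)"
    using assms(1,2) x by (auto simp: continuous_on_def)
  show "((\<lambda>x. a x + r x *\<^sub>R (b x - a x)) \<longlongrightarrow> a x + r x *\<^sub>R (b x - a x)) (at x within S)"
  proof (cases "a x = b x")
    case False
    then have "(r \<longlongrightarrow> r x) (at x within S)" using c[OF x] by (simp add: continuous_within)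
    then show ?thesis using ab by (intro tendsto_intros)
  next
    case True
    have "((\<lambda>x. norm (b x - a x)) \<longlongrightarrow> norm (b x - a x)) (at x within S)"
      using ab by (intro tendsto_intros)
    then have "((\<lambda>x. norm (b x - a x)) \<longlongrightarrow> 0) (at x within S)" using True by simp
    then have "((\<lambda>x. r x *\<^sub>R (b x - a x)) \<longlongrightarrow> 0) (at x within S)"
    proof (rule tendsto_0_le[where K = 1])
      show "\<forall>\<^sub>F x in at x within S. norm (r x *\<^sub>R (b x - a x)) \<le> norm (norm (b x - a x)) * 1"
        unfolding eventually_at_filter
        by (rule always_eventually) (use r in \<open>auto simp: mult_left_le_one_le\<close>)
    qed
    from tendsto_add[OF ab(1) this] show ?thesis using True by simp
  qed
qed

section \<open>The combing\<close>

text \<open>The combinatorial stand-in for \<open>lev\<close>: the largest N on the closure of the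
  open cell containing the point.\<close>

definition mx :: "pt \<Rightarrow> nat" where
  "mx x = (case x of V g \<Rightarrow> hm 0 (st g)
     | E g s t \<Rightarrow> max (hm 0 (st g)) (hm 0 (st (act g (s, True))))
     | C g i p \<Rightarrow> Max ((\<lambda>j. hm 0 (st (cvertex g i j))) ` {..<length (rels ! i)}))"

definition mx_mono :: "(real \<Rightarrow> pt) \<Rightarrow> bool" where
  "mx_mono p \<longleftrightarrow> (\<forall>s t. 0 \<le> s \<longrightarrow> s \<le> t \<longrightarrow> t \<le> 1 \<longrightarrow> mx (p s) \<le> mx (p t))"

text \<open>Runs \<open>F u\<close> for time 1 and \<open>H u\<close> for time
  \<open>\<sigma> u\<close>, rescaled to the unit interval. For \<open>\<sigma> u = 0\<close>
  exactly \<open>F u\<close> remains on the unit interval, without reparametrisation.\<close>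

definition follow :: "(real \<Rightarrow> real \<Rightarrow> pt) \<Rightarrow> (real \<Rightarrow> real \<Rightarrow> pt) \<Rightarrow> (real \<Rightarrow> real) \<Rightarrow> real \<Rightarrow> real \<Rightarrow> pt" where
  "follow F H \<sigma> u t = (if t * (1 + \<sigma> u) \<le> 1 then F u (t * (1 + \<sigma> u)) else H u (t * (1 + \<sigma> u) - 1))"

lemma continuous_follow:
  assumes F: "continuous_map (top_of_set ({0..1} \<times> {0..1})) XT (\<lambda>(u, t). F u t)"
    and H: "continuous_map (top_of_set {(u, z). u \<in> {0..1} \<and> 0 \<le> z \<and> z \<le> \<sigma> u}) XT (\<lambda>(u, z). H u z)"
    and \<sigma>: "continuous_on {0..1} \<sigma>" "\<And>u. u \<in> {0..1} \<Longrightarrow> 0 \<le> \<sigma> u"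
    and FH: "\<And>u. u \<in> {0..1} \<Longrightarrow> F u 1 = H u 0"
  shows "continuous_map (top_of_set ({0..1} \<times> {0..1})) XT (\<lambda>(u, t). follow F H \<sigma> u t)"
proof -
  let ?S = "{0..1} \<times> {0..1} :: (real \<times> real) set"
  let ?p = "\<lambda>z. snd z * (1 + \<sigma> (fst z))"
  have p: "continuous_on ?S ?p"
    by (intro continuous_intros continuous_on_compose2[OF \<sigma>(1)]) auto
  have pos: "0 \<le> ?p z" if "z \<in> ?S" for z
    using that \<sigma>(2)[of "fst z"] by (auto simp: mem_Times_iff)
  have le: "?p z - 1 \<le> \<sigma> (fst z)" if "z \<in> ?S" for z
  proof -
    have "?p z \<le> 1 * (1 + \<sigma> (fst z))"
      using that \<sigma>(2)[of "fst z"] by (intro mult_right_mono) (auto simp: mem_Times_iff)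
    then show ?thesis by simp
  qed
  have "continuous_map (top_of_set ?S) XT (\<lambda>z. if ?p z \<le> 1 then F (fst z) (?p z) else H (fst z) (?p z - 1))"
  proof (rule continuous_map_cases_le)
    show "continuous_map (top_of_set ?S) euclideanreal ?p" using p by simp
    show "continuous_map (top_of_set ?S) euclideanreal (\<lambda>z. 1)" by simp
    show "continuous_map (subtopology (top_of_set ?S) {z \<in> topspace (top_of_set ?S). ?p z \<le> 1}) XT
        (\<lambda>z. F (fst z) (?p z))"
    proof -
      let ?A = "{z \<in> ?S. ?p z \<le> 1}"
      have "continuous_map (top_of_set ?A) (top_of_set ?S) (\<lambda>z. (fst z, ?p z))"
        using pos by (auto intro!: continuous_intros continuous_on_subset[OF p])
      from continuous_map_compose[OF this F] show ?thesis
        by (simp add: o_def subtopology_subtopology Int_absorb1 Collect_mono_iff)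
    qed
    show "continuous_map (subtopology (top_of_set ?S) {z \<in> topspace (top_of_set ?S). 1 \<le> ?p z}) XT
        (\<lambda>z. H (fst z) (?p z - 1))"
    proof -
      let ?A = "{z \<in> ?S. 1 \<le> ?p z}"
      have "continuous_map (top_of_set ?A) (top_of_set {(u, z). u \<in> {0..1} \<and> 0 \<le> z \<and> z \<le> \<sigma> u})
          (\<lambda>z. (fst z, ?p z - 1))"
        using le by (auto intro!: continuous_intros continuous_on_subset[OF p])
      from continuous_map_compose[OF this H] show ?thesis
        by (simp add: o_def subtopology_subtopology Int_absorb1 Collect_mono_iff)
    qed
    show "F (fst z) (?p z) = H (fst z) (?p z - 1)" if "z \<in> topspace (top_of_set ?S)" "?p z = 1" for z
      using FH[of "fst z"] that by auto
  qed
  then show ?thesis by (simp add: follow_def case_prod_unfold)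
qed

lemma mx_mono_follow:
  assumes F: "mx_mono (F u)" and H: "\<And>z z'. 0 \<le> z \<Longrightarrow> z \<le> z' \<Longrightarrow> z' \<le> \<sigma> u \<Longrightarrow> mx (H u z) \<le> mx (H u z')"
    and FH: "F u 1 = H u 0" and \<sigma>: "0 \<le> \<sigma> u"
  shows "mx_mono (follow F H \<sigma> u)"
  unfolding mx_mono_def
proof (intro allI impI)
  fix s t :: real assume st: "0 \<le> s" "s \<le> t" "t \<le> 1"
  define a b where "a = s * (1 + \<sigma> u)" and "b = t * (1 + \<sigma> u)"
  have "b \<le> 1 * (1 + \<sigma> u)" unfolding b_def using st \<sigma> by (intro mult_right_mono) auto
  moreover have "0 \<le> a" "a \<le> b" using st \<sigma> by (auto simp: a_def b_def intro!: mult_right_mono)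
  ultimately have ab: "0 \<le> a" "a \<le> b" "b - 1 \<le> \<sigma> u" by auto
  consider "b \<le> 1" | "a \<le> 1" "1 < b" | "1 < a" by linarith
  then show "mx (follow F H \<sigma> u s) \<le> mx (follow F H \<sigma> u t)"
  proof cases
    case 1
    then show ?thesis using F ab by (simp add: follow_def mx_mono_def flip: a_def b_def)
  next
    case 2
    then have "mx (F u a) \<le> mx (F u 1)" using F ab by (simp add: mx_mono_def)
    also have "\<dots> \<le> mx (H u (b - 1))" unfolding FH using 2 ab by (intro H) auto
    finally show ?thesis using 2 by (simp add: follow_def flip: a_def b_def)
  next
    case 3
    then have "mx (H u (a - 1)) \<le> mx (H u (b - 1))" using ab by (intro H) auto
    then show ?thesis using 3 ab by (simp add: follow_def flip: a_def b_def)
  qed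
qed

lemma mx_V [simp]: "mx (V g) = hm 0 (st g)"
  by (simp add: mx_def)

lemma mx_emap:
  "0 < t \<Longrightarrow> t < 1 \<Longrightarrow> mx (emap g s t) = max (hm 0 (st g)) (hm 0 (st (act g (s, True))))"
  by (simp add: mx_def emap_def)

lemma mx_trav:
  assumes "0 < t" "t < 1"
  shows "mx (trav h a t) = max (hm 0 (st h)) (hm 0 (st (act h a)))"
proof (cases a)
  case (Pair s b)
  then show ?thesis
    using assms mx_emap[of t h s] mx_emap[of "1 - t" "act h (s, False)" s]
    by (cases b) (simp_all add: trav_def max.commute del: st_act)
qed

lemma mx_trav_le: "0 \<le> t \<Longrightarrow> t \<le> 1 \<Longrightarrow> mx (trav h a t) \<le> max (hm 0 (st h)) (hm 0 (st (act h a)))"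
  using mx_trav[of t h a] by (cases "t = 0"; cases "t = 1") (auto simp del: st_act)

lemma trav_linv: "trav (act h a) (linv a) t = trav h a (1 - t)"
  by (cases a; cases "snd a") (simp_all add: trav_def linv_def)

text \<open>Built with \<open>follow\<close> at \<open>u = 1\<close>, so that the family over the
  edge to the parent ends in \<open>cpath\<close> exactly and not only up to
  reparametrisation.\<close>

function cpath :: "F_elt \<Rightarrow> real \<Rightarrow> pt" where
  "cpath g t = (if st g = init then V g
     else follow (\<lambda>_. cpath (parF g)) (\<lambda>_. trav (parF g) (linv (dirn (st g)))) (\<lambda>u. u) 1 t)"
  by pat_completeness auto
termination
  by (relation "inv_image parent_less (st \<circ> fst)") (auto simp: wf_parent_less parF_def parent)

declare cpath.simps [simp del]

text \<open>Prescribing the two end paths makes families over edges with a common vertex agree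
  there.\<close>

definition good :: "F_elt \<Rightarrow> letter \<Rightarrow> (real \<Rightarrow> real \<Rightarrow> pt) \<Rightarrow> bool" where
  "good h a q \<longleftrightarrow> continuous_map (top_of_set ({0..1} \<times> {0..1})) XT (\<lambda>(u, t). q u t)
     \<and> (\<forall>u\<in>{0..1}. q u 0 = V one_F \<and> q u 1 = trav h a u \<and> mx_mono (q u))
     \<and> (\<forall>t\<in>{0..1}. q 0 t = cpath h t \<and> q 1 t = cpath (act h a) t)"

lemma good_flip:
  assumes "good h a q"
  shows "good (act h a) (linv a) (\<lambda>u. q (1 - u))"
proof -
  have "continuous_map (top_of_set ({0..1} \<times> {0..1})) (top_of_set ({0..1} \<times> {0..1}))
      (\<lambda>(u, t). (1 - u, t) :: real \<times> real)"
    by (auto simp: case_prod_beta intro!: continuous_intros)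
  from continuous_map_compose[OF this, of XT "\<lambda>(u, t). q u t"]
  show ?thesis using assms by (auto simp: good_def o_def case_prod_unfold trav_linv)
qed

definition nice_path :: "F_elt \<Rightarrow> bool" where
  "nice_path g \<longleftrightarrow> continuous_map (top_of_set {0..1}) XT (cpath g) \<and> cpath g 0 = V one_F
     \<and> cpath g 1 = V g \<and> mx_mono (cpath g) \<and> (\<forall>t. cpath g t \<in> X1)"

text \<open>Over a tree edge the paths run to the parent and then a portion \<open>u\<close> of the
  edge. The parent has no larger N, so \<open>mx\<close> equals N of \<open>g\<close> on the rest of
  the edge.\<close>

lemma
  assumes "st g \<noteq> init" and nice: "nice_path (parF g)"
  defines "h \<equiv> parF g" and "a \<equiv> linv (dirn (st g))"
  shows good_tree: "good h a (follow (\<lambda>_. cpath h) (\<lambda>_. trav h a) (\<lambda>u. u))"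
    and nice_path_step: "nice_path g"
proof -
  let ?Q = "follow (\<lambda>_. cpath h) (\<lambda>_. trav h a) (\<lambda>u. u)"
  have g: "act h a = g" by (simp add: h_def a_def parF_def)
  have N: "hm 0 (st h) \<le> hm 0 (st g)"
    using parent(2)[OF valid_st assms(1)] by (simp add: h_def parF_def)
  have pg: "cpath g t = ?Q 1 t" for t
    using assms(1) by (simp add: cpath.simps[of g] h_def a_def)
  have p: "continuous_map (top_of_set {0..1}) XT (cpath h)" "cpath h 0 = V one_F" "cpath h 1 = V h"
    "mx_mono (cpath h)" "\<And>t. cpath h t \<in> X1"
    using nice by (auto simp: nice_path_def h_def)
  have c: "continuous_map (top_of_set ({0..1} \<times> {0..1})) XT (\<lambda>(u, t). ?Q u t)"
  proof (rule continuous_follow)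
    have "continuous_map (top_of_set ({0..1} \<times> {0..1})) (top_of_set {0..1}) (snd :: real \<times> real \<Rightarrow> real)"
      by (auto intro!: continuous_intros)
    from continuous_map_compose[OF this p(1)]
    show "continuous_map (top_of_set ({0..1} \<times> {0..1})) XT (\<lambda>(u :: real, t). cpath h t)"
      by (simp add: o_def case_prod_unfold)
    have "continuous_map (top_of_set {(u, z). u \<in> {0..1} \<and> 0 \<le> z \<and> z \<le> u}) (top_of_set {0..1})
        (snd :: real \<times> real \<Rightarrow> real)"
      by (auto intro!: continuous_intros)
    from continuous_map_compose[OF this continuous_trav[of h a]]
    show "continuous_map (top_of_set {(u :: real, z). u \<in> {0..1} \<and> 0 \<le> z \<and> z \<le> u}) XT
        (\<lambda>(u, z). trav h a z)"
      by (simp add: o_def case_prod_unfold)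
  qed (auto simp: p)
  have m: "mx_mono (?Q u)" if u: "u \<in> {0..1}" for u
  proof (rule mx_mono_follow)
    show "mx (trav h a z) \<le> mx (trav h a z')" if z: "0 \<le> z" "z \<le> z'" "z' \<le> u" for z z'
    proof -
      consider "z = 0" "z' = 0" | "z = 0" "0 < z'" "z' < 1" | "0 < z" "z' < 1" | "z' = 1"
        using z u by (smt (verit) atLeastAtMost_iff)
      then show ?thesis
        by cases (use mx_trav[of z h a] mx_trav[of z' h a] mx_trav_le[of z h a] z u N g
            in \<open>auto simp del: st_act\<close>)
    qed
  qed (use p u in auto)
  have 1: "?Q u 1 = trav h a u" "?Q u 0 = V one_F" if "u \<in> {0..1}" for u
    using that p by (auto simp: follow_def)
  have 0: "?Q 0 t = cpath h t" if "t \<in> {0..1}" for t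
    using that by (simp add: follow_def)
  show "good h a ?Q"
    unfolding good_def g using c m 1 pg 0 by auto
  have "?Q 1 t \<in> X1" for t using p by (simp add: follow_def trav_in_X1)
  then show "nice_path g"
    unfolding nice_path_def pg[abs_def] using continuous_map_slice[OF c, of 1] 1[of 1] m[of 1] g
    by auto
qed

lemma nice_path: "nice_path g"
proof (induction g rule: root.induct)
  case (1 g)
  show ?case
  proof (cases "st g = init")
    case True
    then have g: "g = one_F" by (simp add: st_eq_init_iff)
    have "cpath g = (\<lambda>t. V one_F)" using True g by (intro ext) (simp add: cpath.simps)
    moreover note g
    moreover have "V one_F \<in> X1" by (simp add: X1_def)
    ultimately show ?thesis using X1_subset_Xcar
      by (auto simp: nice_path_def mx_mono_def topspace_XT)
  qed (rule nice_path_step[OF _ 1])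
qed

lemma good_g_tree:
  assumes "g_tree (g, y)"
  shows "\<exists>q. good g (y, True) q"
proof -
  from assms consider "st g \<noteq> init" "dirn (st g) = (y, True)"
    | "st (act g (y, True)) \<noteq> init" "dirn (st (act g (y, True))) = (y, False)"
    by (auto simp: g_tree_def tree_edge_def)
  then show ?thesis
  proof cases
    case 1
    then show ?thesis using good_flip[OF good_tree[OF 1(1) nice_path]]
      by (auto simp: parF_def linv_def)
  next
    case 2
    then show ?thesis using good_tree[OF 2(1) nice_path]
      by (auto simp: parF_def linv_def)
  qed
qed

lemma ex_good_cedge_iff:
  assumes "j < length (rels ! i)" "cedge c i j = (h, y)"
  shows "(\<exists>q. good h (y, True) q) \<longleftrightarrow> (\<exists>q. good (cvertex c i j) (rels ! i ! j) q)"
  using cedge_ends[OF assms]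
proof (elim disjE conjE)
  assume *: "rels ! i ! j = (y, False)" "h = cvertex c i (Suc j)" "act h (y, True) = cvertex c i j"
  then have "act (cvertex c i j) (y, False) = h" using cvertex_Suc[OF assms(1), of c] by simp
  then show ?thesis
    using * good_flip[of h "(y, True)"] good_flip[of "cvertex c i j" "(y, False)"] by (auto simp: linv_def)
qed simp

text \<open>The families over the other sides are glued along the rest of the boundary, and each
  path is prolonged by a chord of the disc to a point of side \<open>k\<close>. Since
  \<open>mx\<close> is constant on the open cell and bounded by that value on its boundary,
  monotonicity survives.\<close>

lemma good_filling:
  assumes f: "filling e c i k"
    and IH: "\<And>j. j < length (rels ! i) \<Longrightarrow> j \<noteq> k \<Longrightarrow> \<exists>q. good (cvertex c i j) (rels ! i ! j) q"
  shows "\<exists>q. good (cvertex c i k) (rels ! i ! k) q"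
proof -
  define n where "n = length (rels ! i)"
  define v where "v = cvertex c i"
  define r where "r = rels ! i"
  have ik: "i < length rels" "k < n" "cedge c i k = e" using f by (auto simp: filling_def n_def)
  have n: "2 \<le> n" using ik(1) by (auto simp: n_def rels_def rel1_eq rel2_eq less_Suc_eq)
  define M where "M = mx (C c i 0)"
  have M: "hm 0 (st (v j)) \<le> M" if "j < n" for j
    unfolding M_def mx_def using that by (auto simp: v_def n_def intro!: Max_ge)
  have vmod: "v (Suc j mod n) = v (Suc j)" if "j < n" for j
    using that cvertex_length[OF ik(1), of c] by (auto simp: mod_Suc v_def n_def cvertex_0)
  have vact: "act (v j) (r ! j) = v (Suc j)" if "j < n" for j
    using that by (simp add: v_def r_def n_def cvertex_Suc)
  have M': "hm 0 (st (v (Suc j))) \<le> M" if "j < n" for j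
    using M[of "Suc j mod n"] vmod[OF that] n by simp
  have le_M: "mx (cmap c i p) \<le> M" if p: "norm p = 1" for p
  proof -
    obtain j \<tau> where j: "j < n" "0 \<le> \<tau>" "\<tau> \<le> 1" "p = rim i (real j + \<tau>)"
      using rim_surj[OF ik(1) p] n_def by blast
    then have "cmap c i p = trav (v j) (r ! j) \<tau>"
      using cmap_rim[OF ik(1) j(2,3), of c j] by (simp add: n_def v_def r_def)
    then show ?thesis using mx_trav_le[OF j(2,3), of "v j" "r ! j"] M[OF j(1)] M'[OF j(1)] vact[OF j(1)] by simp
  qed
  \<comment> \<open>By the last condition of \<open>filling\<close> an end of side \<open>k\<close>
    attains the boundary maximum, so \<open>mx\<close> keeps its value when a chord reaches the
    interior of that side.\<close>
  have mx_e: "max (hm 0 (st (v k))) (hm 0 (st (v (Suc k)))) = M"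
  proof (rule antisym)
    obtain g x where e: "e = (g, x)" by fastforce
    have "M \<le> hm 0 (st (act g (x, True)))"
      unfolding M_def mx_def pt.case using f n e
      by (subst Max_le_iff) (auto simp: filling_def n_def lessThan_empty_iff)
    moreover have "act g (x, True) \<in> {v k, v (Suc k)}"
      using cedge_ends[of k i c g x] ik e by (auto simp: v_def n_def)
    ultimately show "M \<le> max (hm 0 (st (v k))) (hm 0 (st (v (Suc k))))" by (auto simp del: st_act)
  qed (use M M' ik in auto)
  \<comment> \<open>The sides other than \<open>k\<close> in cyclic order, for arguments below
    \<open>n - 1\<close>.\<close>
  define ix where "ix j = (Suc k + j) mod n" for j
  have ix: "ix j < n" "j < n - 1 \<Longrightarrow> ix j \<noteq> k" for j
  proof -
    show "ix j < n" using n by (simp add: ix_def)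
    assume "j < n - 1"
    then show "ix j \<noteq> k" using ik(2)
      by (cases "Suc k + j < n") (auto simp: ix_def mod_if)
  qed
  have ixS: "v (ix (Suc j)) = v (Suc (ix j))" for j
    using vmod[OF ix(1), of j] by (simp add: ix_def mod_Suc_eq)
  have "\<forall>j. \<exists>q. j < n - 1 \<longrightarrow> good (v (ix j)) (r ! ix j) q"
    using IH ix unfolding v_def r_def n_def by blast
  then obtain q where q: "\<And>j. j < n - 1 \<Longrightarrow> good (v (ix j)) (r ! ix j) (q j)"
    unfolding choice_iff by blast
  have qcont: "continuous_map (top_of_set ({0..1} \<times> {0..1})) XT (\<lambda>(u, t). q j u t)" if "j < n - 1" for j
    using q[OF that] by (simp add: good_def)
  have qeq: "q j 1 t = q (Suc j) 0 t" if "Suc j < n - 1" "t \<in> {0..1}" for j t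
    using q[of j] q[of "Suc j"] that ixS[of j] vact[OF ix(1), of j] by (simp add: good_def)
  obtain F where F: "continuous_map (top_of_set ({0..real (n - 1)} \<times> {0..1})) XT (\<lambda>(u, t). F u t)"
    "\<And>j u t. j < n - 1 \<Longrightarrow> u \<in> {0..1} \<Longrightarrow> t \<in> {0..1} \<Longrightarrow> F (real j + u) t = q j u t"
    using glue_strips[of "n - 1" XT q, OF _ qcont qeq] n by auto
  have dec: "\<exists>j u. j < n - 1 \<and> u \<in> {0..1} \<and> real (n - 1) * w = real j + u" if "w \<in> {0..1}" for w
  proof (cases "w = 1")
    case True
    then show ?thesis using n by (intro exI[of _ "n - 2"] exI[of _ 1]) (auto simp: of_nat_diff)
  next
    case False
    define x where "x = real (n - 1) * w"
    have "0 \<le> x" "x < real (n - 1)" using that False n by (auto simp: x_def)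
    then have "nat \<lfloor>x\<rfloor> < n - 1" "0 \<le> x - real (nat \<lfloor>x\<rfloor>)" "x - real (nat \<lfloor>x\<rfloor>) \<le> 1" by linarith+
    then show ?thesis
      unfolding x_def[symmetric] by (intro exI[of _ "nat \<lfloor>x\<rfloor>"] exI[of _ "x - real (nat \<lfloor>x\<rfloor>)"]) auto
  qed
  define G where "G w t = F (real (n - 1) * w) t" for w t
  \<comment> \<open>\<open>\<gamma>\<close> walks along the other sides from
    \<open>v (Suc k)\<close> to \<open>v k\<close>, while \<open>\<eta>\<close> takes side
    \<open>k\<close> backwards between the same vertices.\<close>
  define \<gamma> where "\<gamma> w = rim i (real (Suc k) + real (n - 1) * w)" for w
  define \<eta> where "\<eta> w = rim i (real k + (1 - w))" for w
  \<comment> \<open>The sweep time vanishes exactly at the two vertices, where the path has to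
    remain \<open>cpath\<close>; there division by zero gives 0 and \<open>P w z\<close> is
    \<open>\<gamma> w\<close>.\<close>
  define \<sigma> :: "real \<Rightarrow> real" where "\<sigma> w = w * (1 - w)" for w
  define P where "P w z = \<gamma> w + (z / \<sigma> w) *\<^sub>R (\<eta> w - \<gamma> w)" for w z
  define H where "H w z = cmap c i (P w z)" for w z
  have G: "G w 0 = V one_F" "G w 1 = cmap c i (\<gamma> w)" "mx_mono (G w)" if w: "w \<in> {0..1}" for w
  proof -
    obtain j u where j: "j < n - 1" "u \<in> {0..1}" "real (n - 1) * w = real j + u" using dec[OF w] by blast
    have Gq: "G w t = q j u t" if "t \<in> {0..1}" for t using F(2)[OF j(1,2) that] j(3) by (simp add: G_def)
    show "G w 0 = V one_F" using Gq[of 0] q[OF j(1)] j(2) by (simp add: good_def)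
    have "mx_mono (q j u)" using q[OF j(1)] j(2) by (simp add: good_def)
    then show "mx_mono (G w)" using Gq by (simp add: mx_mono_def)
    have "\<gamma> w = rim i (real (Suc k + j) + u)" using j(3) by (simp add: \<gamma>_def add.assoc)
    then show "G w 1 = cmap c i (\<gamma> w)"
      using Gq[of 1] q[OF j(1)] j(2) cmap_rim[OF ik(1), of u c "Suc k + j"]
      by (simp add: good_def v_def r_def n_def ix_def)
  qed
  have G0: "G 0 t = cpath (v (Suc k)) t" if "t \<in> {0..1}" for t
    using F(2)[of 0 0 t] q[of 0] that n vmod[OF ik(2)] by (simp add: G_def good_def ix_def)
  have G1: "G 1 t = cpath (v k) t" if "t \<in> {0..1}" for t
  proof -
    have "v (Suc (ix (n - 2))) = v (ix (n - 1))" using ixS[of "n - 2"] n by (simp add: Suc_diff_Suc numeral_2_eq_2)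
    also have "ix (n - 1) = k" using n ik(2) by (simp add: ix_def)
    finally have "act (v (ix (n - 2))) (r ! ix (n - 2)) = v k" using vact[OF ix(1)] by simp
    moreover have "real (n - 2) + 1 = real (n - 1)" using n by (simp add: of_nat_diff)
    ultimately show ?thesis using F(2)[of "n - 2" 1 t] q[of "n - 2"] that n by (simp add: G_def good_def)
  qed
  have ends: "\<gamma> 0 = \<eta> 0" "\<gamma> 1 = \<eta> 1"
    using rim_mod[OF length_rels_pos[OF ik(1)], of "k + n" 0] ik n by (auto simp: \<gamma>_def \<eta>_def n_def of_nat_diff algebra_simps)
  have \<sigma>: "0 \<le> \<sigma> w" "\<sigma> w = 0 \<longleftrightarrow> w = 0 \<or> w = 1" if "w \<in> {0..1}" for w
    using that by (auto simp: \<sigma>_def)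
  have norm1: "norm (\<gamma> w) = 1" "norm (\<eta> w) = 1" for w by (simp_all add: \<gamma>_def \<eta>_def)
  have \<eta>: "cmap c i (\<eta> w) = trav (v k) (r ! k) (1 - w)" if "w \<in> {0..1}" for w
    using cmap_rim[OF ik(1), of "1 - w" c k] that ik(2) by (simp add: \<eta>_def v_def r_def n_def)
  let ?D = "{(w, z). w \<in> {0..1} \<and> 0 \<le> z \<and> z \<le> \<sigma> w}"
  have frac: "0 \<le> z / \<sigma> w \<and> z / \<sigma> w \<le> 1" if "w \<in> {0..1}" "0 \<le> z" "z \<le> \<sigma> w" for w z
    using that \<sigma>[of w] by (cases "\<sigma> w = 0") (auto simp: divide_le_eq_1)
  have Pc: "P w z \<in> closed_segment (\<gamma> w) (\<eta> w)" if "w \<in> {0..1}" "0 \<le> z" "z \<le> \<sigma> w" for w z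
    unfolding in_segment P_def using frac[OF that]
    by (intro exI[of _ "z / \<sigma> w"]) (auto simp: algebra_simps)
  have Pball: "P w z \<in> cball 0 1" if "w \<in> {0..1}" "0 \<le> z" "z \<le> \<sigma> w" for w z
    using closed_segment_subset[of "\<gamma> w" "cball 0 1" "\<eta> w"] Pc[OF that] norm1 by auto
  have Pcont: "continuous_on ?D (\<lambda>(w, z). P w z)"
  proof -
    have "continuous_on ?D (\<lambda>x. \<gamma> (fst x) + (snd x / \<sigma> (fst x)) *\<^sub>R (\<eta> (fst x) - \<gamma> (fst x)))"
    proof (rule continuous_on_shrinking_segment)
      show "continuous_on ?D (\<lambda>x. \<gamma> (fst x))" "continuous_on ?D (\<lambda>x. \<eta> (fst x))"
        unfolding \<gamma>_def \<eta>_def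
        by (intro continuous_on_compose2[OF continuous_rim[of UNIV]] continuous_intros; simp)+
      show "continuous (at x within ?D) (\<lambda>x. snd x / \<sigma> (fst x))" if "x \<in> ?D" "\<gamma> (fst x) \<noteq> \<eta> (fst x)" for x
      proof -
        have "\<sigma> (fst x) \<noteq> 0" using that \<sigma>(2)[of "fst x"] ends by auto
        then show ?thesis unfolding \<sigma>_def by (intro continuous_intros) auto
      qed
    qed (use frac in auto)
    then show ?thesis by (simp add: P_def case_prod_unfold)
  qed
  have Hcont: "continuous_map (top_of_set ?D) XT (\<lambda>(w, z). H w z)"
  proof -
    have "continuous_map (top_of_set ?D) (top_of_set (cball 0 1)) (\<lambda>(w, z). P w z)"
      using Pcont Pball by (auto simp: continuous_map_in_subtopology)
    from continuous_map_compose[OF this continuous_cmap[OF ik(1)]] show ?thesis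
      by (simp add: o_def case_prod_unfold H_def)
  qed
  have Gcont: "continuous_map (top_of_set ({0..1} \<times> {0..1})) XT (\<lambda>(w, t). G w t)"
  proof -
    have "continuous_map (top_of_set ({0..1} \<times> {0..1})) (top_of_set ({0..real (n - 1)} \<times> {0..1}))
        (\<lambda>(w, t). (real (n - 1) * w, t))"
      by (auto simp: case_prod_beta mult_left_le intro!: continuous_intros)
    from continuous_map_compose[OF this F(1)] show ?thesis
      by (simp add: o_def case_prod_unfold G_def)
  qed
  have HM: "mx (H w z) = M" if w: "w \<in> {0..1}" and z: "0 < z" "z \<le> \<sigma> w" for w z
  proof -
    have "\<sigma> w \<noteq> 0" using z by auto
    then have w': "0 < w" "w < 1" using \<sigma>(2)[OF w] w by (auto simp: order.order_iff_strict)
    have e: "mx (cmap c i (\<eta> w)) = M"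
      using \<eta>[OF w] mx_trav[of "1 - w" "v k" "r ! k"] w' mx_e vact[OF ik(2)] by simp
    show ?thesis
    proof (cases "P w z = \<eta> w")
      case True
      then show ?thesis using e by (simp add: H_def)
    next
      case False
      have "\<gamma> w \<noteq> \<eta> w" "z \<noteq> \<sigma> w" using False \<open>\<sigma> w \<noteq> 0\<close> by (auto simp: P_def)
      then have "P w z \<in> open_segment (\<gamma> w) (\<eta> w)"
        unfolding in_segment P_def using z
        by (intro conjI exI[of _ "z / \<sigma> w"]) (auto simp: algebra_simps)
      \<comment> \<open>Inner points of a chord lie in the open disc, by strict convexity.\<close>
      then have "norm (P w z) < 1"
        using open_segment_furthest_le[of "P w z" "\<gamma> w" "\<eta> w" 0] norm1 by simp
      then show ?thesis by (simp add: H_def cmap_def M_def mx_def)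
    qed
  qed
  have H0: "H w 0 = cmap c i (\<gamma> w)" for w by (simp add: H_def P_def)
  have Q: "good (v (Suc k)) (linv (r ! k)) (follow G H \<sigma>)"
    unfolding good_def
  proof (intro conjI ballI)
    show "continuous_map (top_of_set ({0..1} \<times> {0..1})) XT (\<lambda>(u, t). follow G H \<sigma> u t)"
    proof (rule continuous_follow[OF Gcont Hcont])
      show "continuous_on {0..1} \<sigma>" unfolding \<sigma>_def by (intro continuous_intros)
    qed (use \<sigma> G(2) H0 in auto)
    fix w :: real assume w: "w \<in> {0..1}"
    show "follow G H \<sigma> w 0 = V one_F" using G(1)[OF w] by (simp add: follow_def)
    show "mx_mono (follow G H \<sigma> w)"
    proof (rule mx_mono_follow)
      show "mx (H w z) \<le> mx (H w z')" if z: "0 \<le> z" "z \<le> z'" "z' \<le> \<sigma> w" for z z'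
      proof (cases "z = 0")
        case True
        then show ?thesis using HM[OF w, of z'] le_M[OF norm1(1)] H0 z by (cases "z' = 0") auto
      next
        case False
        then show ?thesis using HM[OF w, of z] HM[OF w, of z'] z by simp
      qed
    qed (use G[OF w] H0 \<sigma>[OF w] in auto)
    have "follow G H \<sigma> w 1 = cmap c i (\<eta> w)"
    proof (cases "\<sigma> w = 0")
      case True
      then show ?thesis using \<sigma>(2)[OF w] ends G(2)[OF w] by (auto simp: follow_def)
    next
      case False
      then show ?thesis using \<sigma>(1)[OF w] by (simp add: follow_def H_def P_def)
    qed
    then show "follow G H \<sigma> w 1 = trav (v (Suc k)) (linv (r ! k)) w"
      using \<eta>[OF w] trav_linv[of "v k" "r ! k" w] vact[OF ik(2)] by simp
  next
    fix t :: real assume t: "t \<in> {0..1}"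
    show "follow G H \<sigma> 0 t = cpath (v (Suc k)) t" using G0[OF t] t by (simp add: follow_def \<sigma>_def)
    have "act (v (Suc k)) (linv (r ! k)) = v k" using vact[OF ik(2)] by (metis act_linv)
    then show "follow G H \<sigma> 1 t = cpath (act (v (Suc k)) (linv (r ! k))) t"
      using G1[OF t] t by (simp add: follow_def \<sigma>_def)
  qed
  have "act (v (Suc k)) (linv (r ! k)) = v k" using vact[OF ik(2)] by (metis act_linv)
  then show ?thesis using good_flip[OF Q] by (auto simp: v_def r_def)
qed

text \<open>The induction of \<open>root_edge\<close> again, with families of paths instead of equal
  roots.\<close>

lemma ex_good: "\<exists>q. good (fst e) (snd e, True) q"
proof (induction e rule: wf_induct_rule[OF wf_g_less])
  case (1 e)
  show ?case
  proof (cases "g_tree e")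
    case True
    then show ?thesis using good_g_tree[of "fst e" "snd e"] by simp
  next
    case False
    then obtain c i k where f: "filling e c i k" using filling_ex by blast
    have "\<exists>q. good (cvertex c i j) (rels ! i ! j) q" if j: "j < length (rels ! i)" "j \<noteq> k" for j
    proof -
      obtain h y where e': "cedge c i j = (h, y)" by fastforce
      have "\<exists>q. good h (y, True) q"
        using f j 1[of "(h, y)"] good_g_tree[of h y] e' by (auto simp: filling_def)
      then show ?thesis using ex_good_cedge_iff[OF j(1) e'] by simp
    qed
    from good_filling[OF f this] show ?thesis
      using f ex_good_cedge_iff[of k i c "fst e" "snd e"] by (auto simp: filling_def)
  qed
qed

section \<open>Levels and radial tameness\<close>

text \<open>Word length changes by at most 1 along an edge, and two vertices of a loop of length at
  most 14 are joined by an arc of at most 7 sides.\<close>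

lemma wl_cvertex_dist:
  assumes "i < length rels" "length (rels ! i) \<le> 14" "j < length (rels ! i)" "k < length (rels ! i)"
  shows "wl (cvertex c i j) \<le> wl (cvertex c i k) + 7"
proof -
  let ?v = "cvertex c i" and ?n = "length (rels ! i)"
  have lip: "\<bar>int (wl (?v a)) - int (wl (?v (a + d)))\<bar> \<le> int d" if "a + d \<le> ?n" for a d
    using that
  proof (induction d)
    case (Suc d)
    then show ?case
      using wl_act_le[of "?v (a + d)" "rels ! i ! (a + d)"] wl_act_ge[of "?v (a + d)" "rels ! i ! (a + d)"]
      by (simp add: cvertex_Suc)
  qed simp
  have *: "\<bar>int (wl (?v a)) - int (wl (?v b))\<bar> \<le> 7" if "a \<le> b" "b < ?n" for a b
  proof -
    have "\<bar>int (wl (?v a)) - int (wl (?v b))\<bar> \<le> int (b - a)" using lip[of a "b - a"] that by simp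
    moreover have "\<bar>int (wl (?v a)) - int (wl (?v b))\<bar> \<le> int a + int (?n - b)"
      using lip[of 0 a] lip[of b "?n - b"] that cvertex_length[OF assms(1), of c] by (simp add: cvertex_0)
    ultimately show ?thesis using assms(2) that by linarith
  qed
  show ?thesis using *[of j k] *[of k j] assms(3,4) by (cases "j \<le> k") auto
qed

text \<open>The relators have lengths 10 and 14, and 4 * 10 * 14 + 1 = 561.\<close>

lemma cconst_eq: "cconst = 561"
  by (simp add: cconst_def rels_def rel1_eq rel2_eq)

text \<open>The level is a mean of word lengths plus less than 1. Some vertex attains
  \<open>mx\<close> and has word length at least \<open>mx x - 1\<close>; on a 2-cell the others are
  at most 7 shorter, whence the 8.\<close>

lemma lev_bounds:
  assumes "x \<in> Xcar"
  shows "lev x \<le> 4 * real (mx x) + 1" "real (mx x) \<le> lev x + 8"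
proof -
  have up: "real (wl g) \<le> 4 * real (hm 0 (st g))" for g
    using wl_le_hm_0[of g] st_eq_init_iff by (simp flip: of_nat_le_iff[where 'a = real])
  have low: "real (hm 0 (st g)) \<le> real (wl g) + 1" for g
    using hm_0_st_le[of g] by linarith
  have "lev x \<le> 4 * real (mx x) + 1 \<and> real (mx x) \<le> lev x + 8"
  proof (cases x)
    case (V g)
    then show ?thesis using up[of g] low[of g] by (simp add: lev_def)
  next
    case (E g s t)
    let ?h = "act g (s, True)"
    have "4 * lev x = 2 * real (wl g) + 2 * real (wl ?h) + 1"
      "real (hm 0 (st g)) \<le> real (mx x)" "real (hm 0 (st ?h)) \<le> real (mx x)"
      and mx: "real (mx x) = real (hm 0 (st g)) \<or> real (mx x) = real (hm 0 (st ?h))"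
      unfolding E by (auto simp add: lev_def mx_def max_def simp del: st_act)
    note E' = this(1-3) up[of g] up[of ?h] low[of g] low[of ?h]
    have wl: "real (wl ?h) \<le> real (wl g) + 1" "real (wl g) \<le> real (wl ?h) + 1"
      using wl_act_le[of g "(s, True)"] wl_act_ge[of g "(s, True)"] by linarith+
    have "L \<le> 4 * m + 1 \<and> m \<le> L + 8"
      if "m = p \<or> m = q" "4 * L = 2 * a + 2 * b + 1" "p \<le> m" "q \<le> m" "a \<le> 4 * p" "b \<le> 4 * q"
        "p \<le> a + 1" "q \<le> b + 1" "b \<le> a + 1" "a \<le> b + 1" for L m a b p q :: real
      using that by auto
    from this[OF mx E' wl] show ?thesis .
  next
    case (C g i p)
    then have i: "i < length rels" using assms by (auto simp: Xcar_def)
    let ?n = "length (rels ! i)"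
    let ?S = "\<Sum>k<?n. real (wl (cvertex g i k))"
    have n: "0 < ?n" "?n \<le> 14" using i by (auto simp: rels_def rel1_eq rel2_eq less_Suc_eq)
    have lev: "lev x = ?S / real ?n + 1 / 4 + 1 / 561"
      unfolding C by (simp add: lev_def cconst_eq cvertex_def Let_def)
    define M where "M = mx x"
    have M: "M = Max ((\<lambda>j. hm 0 (st (cvertex g i j))) ` {..<?n})" unfolding M_def C mx_def by simp
    have le: "real (hm 0 (st (cvertex g i k))) \<le> real M" if "k < ?n" for k
      unfolding M using that by (auto intro!: Max_ge)
    have "M \<in> (\<lambda>j. hm 0 (st (cvertex g i j))) ` {..<?n}" unfolding M using n by (intro Max_in) auto
    then obtain j where j: "j < ?n" "M = hm 0 (st (cvertex g i j))" by auto
    have "?S \<le> real (card {..<?n}) * (4 * real M)"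
    proof (rule sum_bounded_above)
      show "real (wl (cvertex g i k)) \<le> 4 * real M" if "k \<in> {..<?n}" for k
        using up[of "cvertex g i k"] le[of k] that by auto
    qed
    then have "?S / real ?n \<le> 4 * real M" using n by (simp add: field_simps)
    moreover have "real (card {..<?n}) * (real M - 8) \<le> ?S"
    proof (rule sum_bounded_below)
      show "real M - 8 \<le> real (wl (cvertex g i k))" if "k \<in> {..<?n}" for k
        using wl_cvertex_dist[OF i n(2) j(1), of k g] low[of "cvertex g i j"] that j(2) by auto
    qed
    then have "real M - 8 \<le> ?S / real ?n" using n by (simp add: field_simps)
    ultimately show ?thesis unfolding lev M_def[symmetric] by simp
  qed
  then show "lev x \<le> 4 * real (mx x) + 1" "real (mx x) \<le> lev x + 8" by auto
qed

theorem theorem5p4: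
  shows "\<exists>\<Psi>. is_1combing \<Psi> \<and> radial_tameness (\<lambda>q. 4 * real_of_rat q + 45) \<Psi>"
proof -
  obtain Q where Q: "\<And>e. good (fst e) (snd e, True) (Q e)" using ex_good by metis
  \<comment> \<open>The families end in \<open>cpath\<close>, so the value at vertices is consistent
    with them. The value on 2-cells is a default outside the domain.\<close>
  define \<Psi> where "\<Psi> = (\<lambda>(x, t). case x of V g \<Rightarrow> cpath g t | E g s u \<Rightarrow> Q (g, s) u t | C _ _ _ \<Rightarrow> V one_F)"
  have \<Psi>: "\<Psi> (emap g s u, t) = Q (g, s) u t" if "u \<in> {0..1}" "t \<in> {0..1}" for g s u t
    using Q[of "(g, s)"] that by (auto simp: \<Psi>_def emap_def good_def)
  have emap: "trav g (s, True) u = emap g s u" for g s u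
    by (simp add: trav_def)
  have qcont: "continuous_map (top_of_set ({0..1} \<times> {0..1})) XT (\<lambda>(u, t). Q (g, s) u t)" for g s
    using Q[of "(g, s)"] by (simp add: good_def)
  have cont: "continuous_map (prod_topology (subtopology XT X1) (top_of_set {0..1})) XT \<Psi>"
  proof (rule continuous_map_X1_prod)
    show "continuous_map (top_of_set ({0..1} \<times> {0..1})) XT (\<lambda>(u, t). \<Psi> (emap g s u, t))" for g s
      by (rule continuous_map_eq[OF qcont[of g s]]) (auto simp: \<Psi>)
  qed
  have pt: "\<Psi> (x, 0) = V one_F \<and> \<Psi> (x, 1) = x \<and> mx_mono (\<lambda>t. \<Psi> (x, t)) \<and> (\<forall>t\<in>{0..1}. \<Psi> (x, t) \<in> Xcar)"
    if x: "x \<in> X1" for x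
  proof -
    obtain g s u where u: "u \<in> {0..1}" "x = emap g s u" using X1_emap[OF x] .
    have q: "Q (g, s) u 0 = V one_F" "Q (g, s) u 1 = x" "mx_mono (Q (g, s) u)"
      using Q[of "(g, s)"] u by (auto simp: good_def emap)
    have "Q (g, s) u t \<in> Xcar" if "t \<in> {0..1}" for t
      using continuous_map_funspace[OF continuous_map_slice[OF qcont u(1)], of g s] that
      by (auto simp: topspace_XT)
    then show ?thesis using q u \<Psi>[OF u(1)] by (auto simp: mx_mono_def)
  qed
  have "\<Psi> (x, t) \<in> X1" if "x \<in> X0" for x t
    using that nice_path by (auto simp: X0_def \<Psi>_def nice_path_def)
  then have "is_1combing \<Psi>" unfolding is_1combing_def using cont pt by blast
  moreover have "radial_tameness (\<lambda>q. 4 * real_of_rat q + 45) \<Psi>"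
    unfolding radial_tameness_def
  proof (intro ballI allI impI)
    fix x s t q assume x: "x \<in> X1" and st: "0 \<le> s \<and> s < t \<and> t \<le> 1"
      and l: "4 * real_of_rat q + 45 < lev (\<Psi> (x, s))"
    have "mx (\<Psi> (x, s)) \<le> mx (\<Psi> (x, t))" using pt[OF x] st by (simp add: mx_mono_def)
    moreover have "lev (\<Psi> (x, s)) \<le> 4 * real (mx (\<Psi> (x, s))) + 1" "real (mx (\<Psi> (x, t))) \<le> lev (\<Psi> (x, t)) + 8"
      using pt[OF x] st by (auto intro!: lev_bounds)
    \<comment> \<open>From \<open>lev > 4 q + 45\<close> at \<open>s\<close> follows
      \<open>mx > q + 11\<close> there, hence also at \<open>t\<close>, where the level exceeds
      \<open>q + 3\<close>.\<close>
    ultimately show "real_of_rat q < lev (\<Psi> (x, t))" using l by linarith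
  qed
  ultimately show ?thesis by blast
qed

end
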